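(* Let $n\ge1$ and let $V$ be a finite dimensional cyclic $\mathfrak{sl}(n+1)\ltimes\mathbb{C}^{n+1}$-module generated by an $\mathfrak{sl}(n+1)$-highest weight vector $v_\mu\in V$ of weight $\mu=\sum_{i=1}^n\mu_i\omega_i$. Then the elements of the set $\mathcal{J}^\mu$, consisting of the numbers $J^\mu_1$ and $J^\mu_k(i_1,\dots,i_{k-1})$, satisfy: 1. $J^\mu_1\ge1$. 2. The set $\mathcal{J}^\mu$ is bounded. 3. For $2\le k\le n+1$, $J^\mu_k(i_1,\dots,i_{k-1})\le J^\mu_k(j_1,\dots,j_{k-1})$ whenever $(i_1,\dots,i_{k-1})$ and $(j_1,\dots,j_{k-1})$ are admissible and $j_l\le i_l$ for all $1\le l\le k-1$. 4. For $2\le k\le n+1$, $1\le J^\mu_k(i_1,\dots,i_{k-1})\le\mu_{k-1}+1$ for every admissible $(i_1,\dots,i_{k-1})$.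
   Context: Everything is over $\mathbb{C}$ and all modules are finite dimensional. $A_{i,j}$ denotes a matrix unit. In $\mathfrak{sl}(n+1)$ put $E_{p,q}=A_{p,q+1}$, $F_{p,q}=A_{q+1,p}$ for $1\le p\le q\le n$, $H_i=A_{i,i}-A_{i+1,i+1}$, $F_i=F_{i,i}$. $\mathfrak{g}=\mathfrak{sl}(n+1)\ltimes\mathbb{C}^{n+1}$ is the semidirect sum of $\mathfrak{sl}(n+1)$ with its standard representation $\mathfrak{p}=\mathbb{C}^{n+1}$ (an abelian ideal), with standard basis $P_1,\dots,P_{n+1}$, so $[X,P_j]=XP_j$ for $X\in\mathfrak{sl}(n+1)$. $\omega_1,\dots,\omega_n$ are the fundamental weights of $\mathfrak{sl}(n+1)$ ($\omega_i(H_j)=\delta_{ij}$), $\omega_0=\omega_{n+1}=0$. A highest weight vector of weight $\mu=\sum_i\mu_i\omega_i$ is a nonzero vector $v$ with $H_iv=\mu_iv$ and $E_{p,q}v=0$ for all $i,p,q$. $V$ is cyclic with generator $v$ if $V=\mathcal{U}(\mathfrak{g})v$. Maps $\varphi_i$. For an integral weight $\mu=\sum\mu_i\omega_i$ and $1\le k\le s\le n$ put $\mu_{k,s}=-\sum_{i=k}^s(\mu_i+1)$; $P_i^{(\mu(s))}=\bigl(\prod_{k=1}^{i-1}\mu_{k,s-1}\bigr)P_i$ for $1\le i\le s\le n+1$; $F_{i,j}^{(\mu(s))}=\bigl(\prod_{k=i+1}^{j}\mu_{k,s}\bigr)F_{i,j}$ for $1\le i\le j\le s\le n$ (empty products are $1$);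 and define $Q^{(\mu(s))}_k\in\mathcal{U}(\mathfrak{sl}(n+1))$ by $Q^{(\mu(s))}_{s+1}=1$, $Q^{(\mu(s))}_{k}=\sum_{l=k}^{s}Q^{(\mu(s))}_{l+1}F^{(\mu(s))}_{k,l}$ for $1\le k\le s$. For a highest weight vector $v_\mu$ of weight $\mu$ in a $\mathfrak{g}$-module, $\varphi_i(v_\mu)=P^{(\mu(i))}_iv_\mu+\sum_{k=1}^{i-1}Q^{(\mu(i-1))}_kP^{(\mu(i))}_kv_\mu$, $1\le i\le n+1$. Each $\varphi_i(v_\mu)$ is zero or a highest weight vector of weight $\mu+\omega_i-\omega_{i-1}$, so the $\varphi_i$ can be iterated (each time using the weight of the current vector), with $\varphi_i(0)=0$. The numbers $J^\mu$. $J^\mu_1$ is the smallest positive integer with $\varphi_1^{J^\mu_1}(v_\mu)=0$. Recursively, for $2\le k\le n+1$ a tuple of integers $(i_1,\dots,i_{k-1})$ is admissible if $0\le i_1<J^\mu_1$ and $0\le i_h<J^\mu_h(i_1,\dots,i_{h-1})$ for $2\le h\le k-1$; for such a tuple $J^\mu_k(i_1,\dots,i_{k-1})$ is the smallest positive integer $J$ with $\varphi_k^{J}(\varphi_{k-1}^{i_{k-1}}(\cdots\varphi_1^{i_1}(v_\mu)\cdots))=0$. *)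

theory Defs
  imports "HOL-Library.Extended_Nat" "Jordan_Normal_Form.Matrix"
begin

section \<open>The Lie algebra\<close>

text \<open>An element of the semidirect sum is a pair of a traceless matrix and a vector. Matrices and
  vectors of \<^theory>\<open>Jordan_Normal_Form.Matrix\<close> are indexed from 0; all indices below are
  1-based, as usual in Lie theory.\<close>

type_synonym aff = "complex mat \<times> complex vec"

definition sl_carrier :: "nat \<Rightarrow> complex mat set" where
  "sl_carrier n = {X \<in> carrier_mat (n+1) (n+1). (\<Sum>i<n+1. X $$ (i, i)) = 0}"

definition aff_carrier :: "nat \<Rightarrow> aff set" where
  "aff_carrier n = sl_carrier n \<times> carrier_vec (n+1)"

definition aff_add :: "aff \<Rightarrow> aff \<Rightarrow> aff" where
  "aff_add x y = (fst x + fst y, snd x + snd y)"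

definition aff_smult :: "complex \<Rightarrow> aff \<Rightarrow> aff" where
  "aff_smult c x = (c \<cdot>\<^sub>m fst x, c \<cdot>\<^sub>v snd x)"

definition aff_bracket :: "aff \<Rightarrow> aff \<Rightarrow> aff" where
  "aff_bracket x y =
     (fst x * fst y - fst y * fst x, fst x *\<^sub>v snd y - fst y *\<^sub>v snd x)"

definition mat_unit :: "nat \<Rightarrow> nat \<Rightarrow> nat \<Rightarrow> complex mat" where
  "mat_unit n i j = mat (n+1) (n+1) (\<lambda>(r, c). if Suc r = i \<and> Suc c = j then 1 else 0)"

definition of_sl :: "nat \<Rightarrow> complex mat \<Rightarrow> aff" where
  "of_sl n X = (X, 0\<^sub>v (n+1))"

definition elE :: "nat \<Rightarrow> nat \<Rightarrow> nat \<Rightarrow> aff" where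
  "elE n p q = of_sl n (mat_unit n p (q+1))"

definition elF :: "nat \<Rightarrow> nat \<Rightarrow> nat \<Rightarrow> aff" where
  "elF n p q = of_sl n (mat_unit n (q+1) p)"

definition elH :: "nat \<Rightarrow> nat \<Rightarrow> aff" where
  "elH n i = of_sl n (mat_unit n i i - mat_unit n (i+1) (i+1))"

definition elP :: "nat \<Rightarrow> nat \<Rightarrow> aff" where
  "elP n j = (0\<^sub>m (n+1) (n+1), vec (n+1) (\<lambda>r. if Suc r = j then 1 else 0))"


section \<open>Finite dimensional cyclic modules and highest weight vectors\<close>

text \<open>The module is the whole type \<open>'v\<close>, with scalar multiplication \<open>scale\<close>. The values of \<open>rho\<close>
  outside the carrier are irrelevant.\<close>

locale aff_module = finite_dimensional_vector_space scale Basis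
  for scale :: "complex \<Rightarrow> 'v::ab_group_add \<Rightarrow> 'v" and Basis :: "'v set" +
  fixes n :: nat and rho :: "aff \<Rightarrow> 'v \<Rightarrow> 'v"
  assumes rho_linear: "x \<in> aff_carrier n \<Longrightarrow> Vector_Spaces.linear scale scale (rho x)"
    and rho_add: "\<lbrakk>x \<in> aff_carrier n; y \<in> aff_carrier n\<rbrakk>
                    \<Longrightarrow> rho (aff_add x y) w = rho x w + rho y w"
    and rho_smult: "x \<in> aff_carrier n \<Longrightarrow> rho (aff_smult c x) w = scale c (rho x w)"
    and rho_bracket: "\<lbrakk>x \<in> aff_carrier n; y \<in> aff_carrier n\<rbrakk>
                    \<Longrightarrow> rho (aff_bracket x y) w = rho x (rho y w) - rho y (rho x w)"

text \<open>The universal enveloping algebra is spanned by the products \<open>x\<^sub>1 \<cdots> x\<^sub>m\<close> (\<open>m \<ge> 0\<close>) of Lie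
  algebra elements, and such a product acts by composing the actions of its factors.\<close>

definition envelope_orbit ::
  "nat \<Rightarrow> (complex \<Rightarrow> 'v::ab_group_add \<Rightarrow> 'v) \<Rightarrow> (aff \<Rightarrow> 'v \<Rightarrow> 'v) \<Rightarrow> 'v \<Rightarrow> 'v set" where
  "envelope_orbit n scale rho v =
     module.span scale {foldr rho xs v | xs. set xs \<subseteq> aff_carrier n}"

definition cyclic_generator ::
  "nat \<Rightarrow> (complex \<Rightarrow> 'v::ab_group_add \<Rightarrow> 'v) \<Rightarrow> (aff \<Rightarrow> 'v \<Rightarrow> 'v) \<Rightarrow> 'v \<Rightarrow> bool" where
  "cyclic_generator n scale rho v \<longleftrightarrow> envelope_orbit n scale rho v = UNIV"

text \<open>An integral weight is given by its coefficients \<open>\<mu> 1, \<dots>, \<mu> n\<close> with respect to the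
  fundamental weights; other values of \<open>\<mu>\<close> are irrelevant.\<close>

type_synonym weight = "nat \<Rightarrow> int"

definition fund_weight :: "nat \<Rightarrow> nat \<Rightarrow> weight" where
  "fund_weight n i = (\<lambda>j. if 1 \<le> i \<and> i \<le> n \<and> j = i then 1 else 0)"

definition highest_weight_vector ::
  "nat \<Rightarrow> (complex \<Rightarrow> 'v::ab_group_add \<Rightarrow> 'v) \<Rightarrow> (aff \<Rightarrow> 'v \<Rightarrow> 'v) \<Rightarrow> weight \<Rightarrow> 'v \<Rightarrow> bool" where
  "highest_weight_vector n scale rho \<mu> v \<longleftrightarrow>
     v \<noteq> 0 \<and>
     (\<forall>i\<in>{1..n}. rho (elH n i) v = scale (of_int (\<mu> i)) v) \<and>
     (\<forall>p q. 1 \<le> p \<and> p \<le> q \<and> q \<le> n \<longrightarrow> rho (elE n p q) v = 0)"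


section \<open>The maps \<open>\<phi>\<^sub>i\<close>\<close>

definition mu_coeff :: "weight \<Rightarrow> nat \<Rightarrow> nat \<Rightarrow> int" where
  "mu_coeff \<mu> k s = - (\<Sum>i=k..s. (\<mu> i + 1))"

definition P_mod :: "nat \<Rightarrow> weight \<Rightarrow> nat \<Rightarrow> nat \<Rightarrow> aff" where
  "P_mod n \<mu> s i = aff_smult (of_int (\<Prod>k=1..i-1. mu_coeff \<mu> k (s-1))) (elP n i)"

definition F_mod :: "nat \<Rightarrow> weight \<Rightarrow> nat \<Rightarrow> nat \<Rightarrow> nat \<Rightarrow> aff" where
  "F_mod n \<mu> s i j = aff_smult (of_int (\<Prod>k=i+1..j. mu_coeff \<mu> k s)) (elF n i j)"

text \<open>\<open>Q_act n rho \<mu> s k\<close> is the operator by which the enveloping algebra element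
  \<open>Q\<^sub>k\<close> with \<open>Q\<^sub>s\<^sub>+\<^sub>1 = 1\<close> and \<open>Q\<^sub>k = (\<Sum>l=k..s. Q\<^sub>l\<^sub>+\<^sub>1 F\<^sub>k\<^sub>,\<^sub>l)\<close> acts on the module. In the product
  the factor \<open>F\<^sub>k\<^sub>,\<^sub>l\<close> acts first.\<close>

function Q_act ::
  "nat \<Rightarrow> (aff \<Rightarrow> 'v::ab_group_add \<Rightarrow> 'v) \<Rightarrow> weight \<Rightarrow> nat \<Rightarrow> nat \<Rightarrow> 'v \<Rightarrow> 'v" where
  "Q_act n rho \<mu> s k w =
     (if k \<le> s then \<Sum>l=k..s. Q_act n rho \<mu> s (l+1) (rho (F_mod n \<mu> s k l) w) else w)"
  by pat_completeness auto
termination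
  by (relation "measure (\<lambda>(n, rho, \<mu>, s, k, w). s + 1 - k)") auto

declare Q_act.simps [simp del]

definition phi ::
  "nat \<Rightarrow> (aff \<Rightarrow> 'v::ab_group_add \<Rightarrow> 'v) \<Rightarrow> nat \<Rightarrow> weight \<Rightarrow> 'v \<Rightarrow> 'v" where
  "phi n rho i \<mu> v =
     rho (P_mod n \<mu> i i) v + (\<Sum>k=1..i-1. Q_act n rho \<mu> (i-1) k (rho (P_mod n \<mu> i k) v))"

text \<open>To iterate the maps, a vector is carried along with its weight; \<open>\<phi>\<^sub>i\<close> changes the weight by
  \<open>\<omega>\<^sub>i - \<omega>\<^sub>i\<^sub>-\<^sub>1\<close>. Once the vector is 0 it stays 0, whatever the recorded weight.\<close>

definition phi_step ::
  "nat \<Rightarrow> (aff \<Rightarrow> 'v::ab_group_add \<Rightarrow> 'v) \<Rightarrow> nat \<Rightarrow> weight \<times> 'v \<Rightarrow> weight \<times> 'v" where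
  "phi_step n rho i = (\<lambda>(\<mu>, v).
     ((\<lambda>j. \<mu> j + fund_weight n i j - fund_weight n (i-1) j), phi n rho i \<mu> v))"

text \<open>A tuple \<open>(i\<^sub>1, \<dots>, i\<^sub>m)\<close> is the family of values \<open>t 1, \<dots>, t m\<close> of a function
  \<open>t\<close>, whose other values play no role. \<open>phi_iter\<close> applies \<open>\<phi>\<^sub>1\<close> first, \<open>t 1\<close> times.\<close>

primrec phi_iter ::
  "nat \<Rightarrow> (aff \<Rightarrow> 'v::ab_group_add \<Rightarrow> 'v) \<Rightarrow> weight \<Rightarrow> 'v \<Rightarrow> (nat \<Rightarrow> nat) \<Rightarrow> nat \<Rightarrow> weight \<times> 'v"
where
  "phi_iter n rho \<mu> v t 0 = (\<mu>, v)"
| "phi_iter n rho \<mu> v t (Suc m) =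
     (phi_step n rho (Suc m) ^^ t (Suc m)) (phi_iter n rho \<mu> v t m)"


section \<open>The numbers \<open>J\<close>\<close>

text \<open>The smallest positive integer \<open>j\<close> such that \<open>\<phi>\<^sub>k\<^sup>j\<close> annihilates the vector obtained from
  \<open>v\<close> and \<open>(t 1, \<dots>, t (k-1))\<close>. It is an extended natural number, equal to \<open>\<infinity>\<close> exactly if there
  is no such \<open>j\<close>; hence its finiteness is not presupposed by the definition. For \<open>k = 1\<close> the
  tuple is empty.\<close>

definition J_num ::
  "nat \<Rightarrow> (aff \<Rightarrow> 'v::ab_group_add \<Rightarrow> 'v) \<Rightarrow> weight \<Rightarrow> 'v \<Rightarrow> nat \<Rightarrow> (nat \<Rightarrow> nat) \<Rightarrow> enat" where
  "J_num n rho \<mu> v k t =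
     Inf {enat j | j. 0 < j \<and> snd ((phi_step n rho k ^^ j) (phi_iter n rho \<mu> v t (k-1))) = 0}"

text \<open>Admissibility of \<open>(t 1, \<dots>, t (k-1))\<close>; it is vacuous for \<open>k = 1\<close>.\<close>

definition admissible ::
  "nat \<Rightarrow> (aff \<Rightarrow> 'v::ab_group_add \<Rightarrow> 'v) \<Rightarrow> weight \<Rightarrow> 'v \<Rightarrow> nat \<Rightarrow> (nat \<Rightarrow> nat) \<Rightarrow> bool" where
  "admissible n rho \<mu> v k t \<longleftrightarrow> (\<forall>h\<in>{1..k-1}. enat (t h) < J_num n rho \<mu> v h t)"

definition J_set ::
  "nat \<Rightarrow> (aff \<Rightarrow> 'v::ab_group_add \<Rightarrow> 'v) \<Rightarrow> weight \<Rightarrow> 'v \<Rightarrow> enat set" where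
  "J_set n rho \<mu> v =
     {J_num n rho \<mu> v k t | k t. 1 \<le> k \<and> k \<le> n + 1 \<and> admissible n rho \<mu> v k t}"

end

theory Submission
  imports Defs
begin

text \<open>Everything follows from one fact: the maps \<open>\<phi>\<^sub>i\<close> commute with each other on highest weight
vectors. Given this, \<open>\<phi>\<^sub>k\<^sup>m \<phi>\<^sub>k\<^sub>-\<^sub>1\<^sup>i \<cdots> \<phi>\<^sub>1\<^sup>j v\<close> equals \<open>\<phi>\<^sub>k\<^sub>-\<^sub>1\<^sup>i \<cdots> \<phi>\<^sub>1\<^sup>j \<phi>\<^sub>k\<^sup>m v\<close>. For \<open>k \<ge> 2\<close> every application
of \<open>\<phi>\<^sub>k\<close> lowers the coefficient of \<open>\<omega>\<^sub>k\<^sub>-\<^sub>1\<close> by one, and a nonzero highest weight vector of a finite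
dimensional module has a dominant weight; so \<open>\<phi>\<^sub>k\<^sup>m v = 0\<close> as soon as \<open>m > \<mu>\<^sub>k\<^sub>-\<^sub>1\<close>, which bounds \<open>J\<^sub>k\<close>.
Likewise, if \<open>\<phi>\<^sub>k\<^sup>m\<close> kills the vector of a tuple, it kills the vector of every larger tuple, which is
obtained by applying further \<open>\<phi>\<^sub>l\<close>; this is the monotonicity. Finally \<open>\<phi>\<^sub>1\<close> raises the
eigenvalue of \<open>H\<^sub>1\<close>, which has only finitely many eigenvalues, so \<open>J\<^sub>1\<close> is finite.

Commutation rests on two ingredients. First, a direct computation along the recursion of the \<open>Q\<^sub>k\<close>
(\<open>raising_phi\<close>) shows that \<open>\<phi>\<^sub>i v\<close> is again annihilated by all raising operators. Second, in a
finite dimensional module a highest weight vector that is a sum of images of lowering operators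
vanishes (\<open>highest_weight_not_low\<close>). Hence \<open>\<phi>\<^sub>j \<phi>\<^sub>i v - \<phi>\<^sub>i \<phi>\<^sub>j v\<close> need only be computed modulo such
images. There \<open>\<phi>\<^sub>j \<phi>\<^sub>i v\<close> collapses to a scalar times \<open>P\<^sub>j P\<^sub>i v\<close> (\<open>phi_phi_mod_low\<close>), and
the scalars of the two orders agree (\<open>Pcoeff_shift_high\<close>, \<open>Pcoeff_shift_low\<close>).

The second ingredient is proved without complete reducibility, by means of the Casimir operator
(\<open>highest_weight_vec_not_lowered\<close>), for which it is convenient to let \<open>gl(n+1)\<close> act.\<close>


section \<open>Eigenvalues and injective maps in finite dimension\<close>

text \<open>Eigenvectors for distinct eigenvalues are independent: \<open>(T - c\<^sub>0) \<cdots> (T - c\<^sub>m\<^sub>-\<^sub>1)\<close> kills the span of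
the first \<open>m\<close> of them but not the next one. So finite dimension makes every ladder of
eigenvectors, indexed by distinct eigenvalues, break off. This is the only source of finiteness below.\<close>

lemma (in finite_dimensional_vector_space) no_infinite_eigenvalue_ladder:
  fixes T :: "'b \<Rightarrow> 'b" and c :: "nat \<Rightarrow> 'a" and w :: "nat \<Rightarrow> 'b"
  assumes T: "Vector_Spaces.linear scale scale T"
    and c: "inj c"
    and eig: "\<And>k. T (w k) = scale (c k) (w k)"
  shows "\<exists>k. w k = 0"
proof (rule ccontr)
  assume "\<not> ?thesis"
  then have nz: "w k \<noteq> 0" for k by blast
  interpret T: Vector_Spaces.linear scale scale T by (rule T)
  \<comment> \<open>\<open>A m\<close> is the product of the operators \<open>T - c j\<close> with \<open>j < m\<close>.\<close>
  define A where "A = rec_nat id (\<lambda>m S u. T (S u) - scale (c m) (S u))"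
  have A_0: "A 0 u = u" and A_Suc: "A (Suc m) u = T (A m u) - scale (c m) (A m u)" for m u
    by (simp_all add: A_def)
  have A_add: "A m (u + u') = A m u + A m u'" and A_scale: "A m (scale a u) = scale a (A m u)"
    for m u u' a
    by (induction m) (simp_all add: A_0 A_Suc T.add T.scale scale_right_distrib
        scale_right_diff_distrib mult.commute)
  have A_w: "A m (w k) = scale (\<Prod>j<m. c k - c j) (w k)" for m k
  proof (induction m)
    case (Suc m)
    have "A (Suc m) (w k) = scale ((\<Prod>j<m. c k - c j) * c k) (w k) - scale (c m * (\<Prod>j<m. c k - c j)) (w k)"
      by (simp add: A_Suc Suc T.scale eig)
    also have "\<dots> = scale ((\<Prod>j<m. c k - c j) * (c k - c m)) (w k)"
      by (simp only: scale_left_diff_distrib[symmetric] right_diff_distrib mult.commute[of "c m"])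
    finally have "A (Suc m) (w k) = scale ((\<Prod>j<m. c k - c j) * (c k - c m)) (w k)" .
    then show ?case by simp
  qed (simp add: A_0)
  have kill: "A m u = 0" if "u \<in> span (w ` {..<m})" for m u
    using that
  proof (induction rule: span_induct_alt)
    case base
    show ?case using A_scale[of m 0 0] by simp
  next
    case (step a x y)
    then obtain k where "k < m" "x = w k" by auto
    then have "A m x = 0" by (auto simp: A_w)
    then show ?case using step by (simp add: A_add A_scale)
  qed
  have notin: "w m \<notin> span (w ` {..<m})" for m
  proof
    assume "w m \<in> span (w ` {..<m})"
    then have "scale (\<Prod>j<m. c m - c j) (w m) = 0"
      using kill[of "w m" m] by (simp only: A_w)
    moreover have "(\<Prod>j<m. c m - c j) \<noteq> 0" using c by (auto simp: inj_eq)
    ultimately show False using nz by simp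
  qed
  have indep: "independent (w ` {..<m}) \<and> card (w ` {..<m}) = m" for m
  proof (induction m)
    case (Suc m)
    have "w m \<notin> w ` {..<m}" using notin[of m] span_base[of "w m"] by metis
    moreover have "independent (insert (w m) (w ` {..<m}))"
      using Suc notin[of m] by (intro independent_insertI) simp_all
    ultimately show ?case using Suc by (simp add: lessThan_Suc)
  qed (simp add: independent_empty)
  have "card (w ` {..<Suc (dim UNIV)}) \<le> dim UNIV"
    using indep by (intro independent_card_le_dim) auto
  moreover have "card (w ` {..<Suc (dim UNIV)}) = Suc (dim UNIV)"
    using indep by blast
  ultimately show False by linarith
qed

lemma (in finite_dimensional_vector_space) injective_on_subspace_imp_surjective:
  assumes T: "Vector_Spaces.linear scale scale T"
    and S: "subspace S"
    and stable: "\<And>x. x \<in> S \<Longrightarrow> T x \<in> S"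
    and inj: "\<And>x. x \<in> S \<Longrightarrow> T x = 0 \<Longrightarrow> x = 0"
    and y: "y \<in> S"
  shows "\<exists>x\<in>S. T x = y"
proof -
  interpret T: Vector_Spaces.linear scale scale T by (rule T)
  have "span S = S" using S by (simp add: span_eq_iff)
  have "inj_on T S"
  proof (rule inj_onI)
    fix x x' assume *: "x \<in> S" "x' \<in> S" "T x = T x'"
    then have "x - x' = 0" using inj[of "x - x'"] by (simp add: T.diff S subspace_diff)
    then show "x = x'" by simp
  qed
  interpret p: finite_dimensional_vector_space_pair scale Basis scale Basis ..
  have "dim (T ` S) = dim S"
    using \<open>inj_on T S\<close> \<open>span S = S\<close> by (intro p.dim_image_eq T) (simp only:)
  moreover have "subspace (T ` S)" using S by (rule T.subspace_image)
  ultimately have "T ` S = S"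
    using S stable by (intro subspace_dim_equal) auto
  then show ?thesis using y by (metis imageE)
qed


section \<open>Finite dimensional representations of gl(N)\<close>

text \<open>The commutation relations of the matrix units of \<open>gl(N)\<close>, realised by operators on a finite
dimensional space. The full \<open>gl(N)\<close> is used because its relations and its Casimir operator are uniform
in the indices, whereas those of \<open>sl(N)\<close> treat the diagonal separately.\<close>

locale gl_module = finite_dimensional_vector_space scale Basis
  for scale :: "complex \<Rightarrow> 'v::ab_group_add \<Rightarrow> 'v" (infixr \<open>*s\<close> 75) and Basis :: "'v set" +
  fixes N :: nat and X :: "nat \<Rightarrow> nat \<Rightarrow> 'v \<Rightarrow> 'v"
  assumes X_linear: "\<lbrakk>i \<in> {1..N}; j \<in> {1..N}\<rbrakk> \<Longrightarrow> Vector_Spaces.linear scale scale (X i j)"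
    and X_commutator: "\<lbrakk>i \<in> {1..N}; j \<in> {1..N}; k \<in> {1..N}; l \<in> {1..N}\<rbrakk> \<Longrightarrow>
      X i j (X k l w) - X k l (X i j w)
        = (if j = k then X i l w else 0) - (if l = i then X k j w else 0)"

definition eps :: "nat \<Rightarrow> nat \<Rightarrow> int" where
  "eps i = (\<lambda>m. if m = i then 1 else 0)"

context gl_module
begin

lemma
  assumes "i \<in> {1..N}" "j \<in> {1..N}"
  shows X_add: "X i j (u + w) = X i j u + X i j w"
    and X_diff: "X i j (u - w) = X i j u - X i j w"
    and X_scale: "X i j (c *s w) = c *s X i j w"
    and X_zero: "X i j 0 = 0"
    and X_sum: "X i j (sum f A) = (\<Sum>a\<in>A. X i j (f a))"
proof -
  interpret l: Vector_Spaces.linear scale scale "X i j" using assms by (rule X_linear)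
  show "X i j (u + w) = X i j u + X i j w" "X i j (u - w) = X i j u - X i j w"
    "X i j (c *s w) = c *s X i j w" "X i j 0 = 0" "X i j (sum f A) = (\<Sum>a\<in>A. X i j (f a))"
    by (simp_all add: l.add l.diff l.scale l.sum)
qed

lemma X_swap:
  assumes "i \<in> {1..N}" "j \<in> {1..N}" "k \<in> {1..N}" "l \<in> {1..N}"
  shows "X i j (X k l w) = X k l (X i j w)
    + ((if j = k then X i l w else 0) - (if l = i then X k j w else 0))"
  using X_commutator[OF assms, of w] by (simp add: algebra_simps)

definition casimir :: "'v \<Rightarrow> 'v" where
  "casimir w = (\<Sum>i=1..N. \<Sum>j=1..N. X i j (X j i w))"

lemma casimir_linear: "Vector_Spaces.linear scale scale casimir"
proof (unfold_locales, goal_cases)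
  case (1 u w)
  then show ?case by (simp add: casimir_def X_add sum.distrib)
next
  case (2 c w)
  then show ?case by (simp add: casimir_def X_scale scale_sum_right)
qed

text \<open>Moving \<open>X\<^sub>k\<^sub>l\<close> past both factors of \<open>X\<^sub>i\<^sub>j X\<^sub>j\<^sub>i\<close> leaves four commutator terms \<open>D i j\<close>, which cancel in
pairs after summation over \<open>i\<close> and \<open>j\<close>.\<close>

lemma casimir_commutes:
  assumes kl: "k \<in> {1..N}" "l \<in> {1..N}"
  shows "casimir (X k l w) = X k l (casimir w)"
proof -
  define D where "D i j = (if l = i then X k j (X j i w) else 0) - (if j = k then X i l (X j i w) else 0)
      + ((if l = j then X i j (X k i w) else 0) - (if i = k then X i j (X j l w) else 0))" for i j
  have D: "X k l (X i j (X j i w)) = X i j (X j i (X k l w)) + D i j"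
    if "i \<in> {1..N}" "j \<in> {1..N}" for i j
  proof -
    have "X k l (X i j (X j i w)) = X i j (X k l (X j i w))
       + ((if l = i then X k j (X j i w) else 0) - (if j = k then X i l (X j i w) else 0))"
      using X_swap[OF kl that, of "X j i w"] by simp
    also have "X i j (X k l (X j i w)) = X i j (X j i (X k l w))
       + ((if l = j then X i j (X k i w) else 0) - (if i = k then X i j (X j l w) else 0))"
      using that kl by (subst X_swap[of k l j i w])
        (auto simp: X_add X_diff X_zero)
    finally show ?thesis by (simp add: D_def algebra_simps)
  qed
  have "X k l (casimir w) = casimir (X k l w) + (\<Sum>i=1..N. \<Sum>j=1..N. D i j)"
    using kl D by (simp add: casimir_def X_sum sum.distrib)
  also have "(\<Sum>i=1..N. \<Sum>j=1..N. D i j) = 0"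
  proof -
    have 1: "(\<Sum>i=1..N. \<Sum>j=1..N. (if l = i then X k j (X j i w) else 0)) = (\<Sum>j=1..N. X k j (X j l w))"
      by (subst sum.swap) (use kl in \<open>simp add: sum.delta'\<close>)
    have 2: "(\<Sum>i=1..N. \<Sum>j=1..N. (if j = k then X i l (X j i w) else 0)) = (\<Sum>i=1..N. X i l (X k i w))"
      using kl by (simp add: sum.delta)
    have 3: "(\<Sum>i=1..N. \<Sum>j=1..N. (if l = j then X i j (X k i w) else 0)) = (\<Sum>i=1..N. X i l (X k i w))"
      using kl by (simp add: sum.delta')
    have 4: "(\<Sum>i=1..N. \<Sum>j=1..N. (if i = k then X i j (X j l w) else 0)) = (\<Sum>j=1..N. X k j (X j l w))"
      by (subst sum.swap) (use kl in \<open>simp add: sum.delta\<close>)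
    show ?thesis unfolding D_def sum.distrib sum_subtractf 1 2 3 4 by simp
  qed
  finally show ?thesis by simp
qed

definition weight_vec :: "(nat \<Rightarrow> int) \<Rightarrow> 'v \<Rightarrow> bool" where
  "weight_vec \<nu> w \<longleftrightarrow> (\<forall>i\<in>{1..N}. X i i w = of_int (\<nu> i) *s w)"

lemma weight_vec_subspace: "subspace {w. weight_vec \<nu> w}"
  unfolding subspace_def weight_vec_def
  by (auto simp: X_add X_scale X_zero scale_right_distrib scale_left_commute)

lemma weight_vec_X:
  assumes w: "weight_vec \<nu> w" and ij: "i \<in> {1..N}" "j \<in> {1..N}"
  shows "weight_vec (\<lambda>m. \<nu> m + eps i m - eps j m) (X i j w)"
  unfolding weight_vec_def
proof
  fix m assume m: "m \<in> {1..N}"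
  have "X m m (X i j w) = X i j (X m m w) + ((if m = i then X m j w else 0) - (if j = m then X i m w else 0))"
    by (rule X_swap[OF m m ij])
  also have "\<dots> = of_int (\<nu> m + eps i m - eps j m) *s X i j w"
    using w m ij by (auto simp: weight_vec_def X_scale eps_def algebra_simps)
  finally show "X m m (X i j w) = of_int (\<nu> m + eps i m - eps j m) *s X i j w" .
qed

lemma casimir_weight_vec:
  assumes "weight_vec \<nu> w" shows "weight_vec \<nu> (casimir w)"
  unfolding weight_vec_def
proof
  fix i assume i: "i \<in> {1..N}"
  interpret c: Vector_Spaces.linear scale scale casimir by (rule casimir_linear)
  show "X i i (casimir w) = of_int (\<nu> i) *s casimir w"
    using assms i by (simp add: casimir_commutes[symmetric] weight_vec_def c.scale)
qed

definition casimir_value :: "(nat \<Rightarrow> int) \<Rightarrow> int" where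
  "casimir_value \<nu> = (\<Sum>i=1..N. \<nu> i * (\<nu> i + int N + 1 - 2 * int i))"

text \<open>The value \<open>(\<lambda>, \<lambda> + 2\<rho>)\<close>, with \<open>N + 1 - 2 i\<close> as the coordinates of \<open>2\<rho>\<close>, is rewritten as a
sum over pairs of indices, the form in which it comes out of reordering the Casimir operator.\<close>

lemma casimir_value_pairs:
  "casimir_value \<nu> = (\<Sum>i=1..N. \<Sum>j=1..N.
     if i = j then \<nu> i * \<nu> i else if i < j then \<nu> i - \<nu> j else 0)"
proof -
  have "(\<Sum>i=1..N. \<Sum>j=1..N. if i = j then \<nu> i * \<nu> i else if i < j then \<nu> i - \<nu> j else 0)
    = (\<Sum>i=1..N. \<Sum>j=1..N. (if i = j then \<nu> i * \<nu> i else 0)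
         + ((if i < j then \<nu> i else 0) - (if i < j then \<nu> j else 0)))"
    by (intro sum.cong) auto
  also have "\<dots> = (\<Sum>i=1..N. \<Sum>j=1..N. if i = j then \<nu> i * \<nu> i else 0)
      + ((\<Sum>i=1..N. \<Sum>j=1..N. if i < j then \<nu> i else 0) - (\<Sum>i=1..N. \<Sum>j=1..N. if i < j then \<nu> j else 0))"
    by (simp add: sum.distrib sum_subtractf)
  also have "(\<Sum>i=1..N. \<Sum>j=1..N. if i < j then \<nu> j else 0) = (\<Sum>j=1..N. \<Sum>i=1..N. if i < j then \<nu> j else 0)"
    by (rule sum.swap)
  also have "\<dots> = (\<Sum>j=1..N. (int j - 1) * \<nu> j)"
  proof (intro sum.cong refl)
    fix j assume j: "j \<in> {1..N}"
    then have "{i \<in> {1..N}. i < j} = {1..<j}" by auto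
    then show "(\<Sum>i=1..N. if i < j then \<nu> j else 0) = (int j - 1) * \<nu> j"
      using j by (simp add: sum.If_cases Int_def of_nat_diff)
  qed
  also have "(\<Sum>i=1..N. \<Sum>j=1..N. if i < j then \<nu> i else 0) = (\<Sum>i=1..N. (int N - int i) * \<nu> i)"
  proof (intro sum.cong refl)
    fix i assume i: "i \<in> {1..N}"
    then have "{j \<in> {1..N}. i < j} = {i<..N}" by auto
    then show "(\<Sum>j=1..N. if i < j then \<nu> i else 0) = (int N - int i) * \<nu> i"
      using i by (simp add: sum.If_cases Int_def of_nat_diff)
  qed
  finally show ?thesis
    by (simp add: casimir_value_def sum.distrib[symmetric] sum_subtractf[symmetric] sum.delta' algebra_simps)
qed

text \<open>In each product with \<open>i < j\<close> the raising operator is moved to the right; the commutators add up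
to the scalar.\<close>

lemma casimir_on_weight_vec:
  assumes w: "weight_vec \<nu> w"
  shows "casimir w = of_int (casimir_value \<nu>) *s w
    + 2 *s (\<Sum>i=1..N. \<Sum>j=1..N. if i < j then X j i (X i j w) else 0)"
proof -
  have sw: "(\<Sum>i=1..N. \<Sum>j=1..N. if j < i then X i j (X j i w) else 0)
     = (\<Sum>i=1..N. \<Sum>j=1..N. if i < j then X j i (X i j w) else 0)"
    by (subst sum.swap) simp
  have "casimir w = (\<Sum>i=1..N. \<Sum>j=1..N.
      of_int (if i = j then \<nu> i * \<nu> i else if i < j then \<nu> i - \<nu> j else 0) *s w
      + ((if i < j then X j i (X i j w) else 0) + (if j < i then X i j (X j i w) else 0)))"
    unfolding casimir_def
  proof (intro sum.cong refl)
    fix i j assume ij: "i \<in> {1..N}" "j \<in> {1..N}"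
    consider "i = j" | "i < j" | "j < i" by linarith
    then show "X i j (X j i w) = of_int (if i = j then \<nu> i * \<nu> i else if i < j then \<nu> i - \<nu> j else 0) *s w
      + ((if i < j then X j i (X i j w) else 0) + (if j < i then X i j (X j i w) else 0))"
    proof cases
      case 1
      then show ?thesis using w ij by (simp add: weight_vec_def X_scale)
    next
      case 2
      then show ?thesis using w ij X_swap[of i j j i w]
        by (simp add: weight_vec_def scale_left_diff_distrib)
    next
      case 3
      then show ?thesis by simp
    qed
  qed
  also have "\<dots> = of_int (casimir_value \<nu>) *s w
     + ((\<Sum>i=1..N. \<Sum>j=1..N. if i < j then X j i (X i j w) else 0)
      + (\<Sum>i=1..N. \<Sum>j=1..N. if j < i then X i j (X j i w) else 0))"
    by (simp add: casimir_value_pairs sum.distrib scale_sum_left)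
  also have "\<dots> = of_int (casimir_value \<nu>) *s w
    + 2 *s (\<Sum>i=1..N. \<Sum>j=1..N. if i < j then X j i (X i j w) else 0)"
    unfolding sw using scale_left_distrib[of 1 1] by simp
  finally show ?thesis .
qed


text \<open>The raising operators are iterated commutators of the simple ones \<open>X\<^sub>p\<^sub>,\<^sub>p\<^sub>+\<^sub>1\<close>.\<close>

lemma raising_from_simple:
  assumes w: "\<And>p. p \<in> {1..<N} \<Longrightarrow> X p (p + 1) w = 0"
    and i: "1 \<le> i" and ij: "i < j" and j: "j \<le> N"
  shows "X i j w = 0"
  using ij j
proof (induction j rule: less_induct)
  case (less j)
  show ?case
  proof (cases "j = i + 1")
    case True
    then show ?thesis using w[of i] i less.prems by simp
  next
    case False
    define k where "k = j - 1"
    then have k: "j = k + 1" "i < k" "k < N" using False less.prems by auto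
    have "X i k w = 0" "X k (k + 1) w = 0" using less.IH[of k] w[of k] k i by auto
    then show ?thesis
      using X_commutator[of i k k "k + 1" w] k i by (simp add: X_zero)
  qed
qed

text \<open>The \<open>sl(2)\<close> argument: with \<open>m = \<nu>\<^sub>p - \<nu>\<^sub>p\<^sub>+\<^sub>1\<close> one has \<open>E F\<^sup>k\<^sup>+\<^sup>1 v = (k + 1) (m - k) F\<^sup>k v\<close>. If \<open>m\<close>
were negative, no factor would vanish and the vectors \<open>F\<^sup>k v\<close> would form an infinite ladder.\<close>

lemma highest_weight_dominant:
  assumes v: "weight_vec \<nu> v" "v \<noteq> 0" and p: "1 \<le> p" "p < N"
    and E: "X p (p + 1) v = 0"
  shows "\<nu> (p + 1) \<le> \<nu> p"
proof (rule ccontr)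
  assume lt: "\<not> ?thesis"
  define m where "m = \<nu> p - \<nu> (p + 1)"
  have m: "m < 0" using lt by (simp add: m_def)
  have r: "p \<in> {1..N}" "p + 1 \<in> {1..N}" using p by auto
  define f where "f k = (X (p + 1) p ^^ k) v" for k
  have f_Suc: "f (Suc k) = X (p + 1) p (f k)" and f_0: "f 0 = v" for k by (simp_all add: f_def)
  define T where "T w = X p p w - X (p + 1) (p + 1) w" for w
  have T_lin: "Vector_Spaces.linear scale scale T"
    using r by unfold_locales (simp_all add: T_def X_add X_scale scale_right_diff_distrib)
  have T_f: "T (f k) = of_int (m - 2 * int k) *s f k" for k
  proof (induction k)
    case 0
    show ?case using v r by (simp add: f_0 T_def m_def weight_vec_def scale_left_diff_distrib)
  next
    case (Suc k)
    have "T (f (Suc k)) = X (p + 1) p (T (f k)) - 2 *s f (Suc k)"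
      using X_swap[OF r(1) r(1) r(2) r(1), of "f k"] X_swap[OF r(2) r(2) r(2) r(1), of "f k"] r
        scale_left_distrib[of 1 1 "f (Suc k)"]
      by (simp add: T_def f_Suc X_diff)
    also have "X (p + 1) p (T (f k)) = of_int (m - 2 * int k) *s f (Suc k)"
      using r by (simp only: Suc X_scale f_Suc)
    also have "\<dots> - 2 *s f (Suc k) = (of_int (m - 2 * int k) - 2) *s f (Suc k)"
      by (simp only: scale_left_diff_distrib)
    finally show ?case by (simp add: algebra_simps)
  qed
  have E_f: "X p (p + 1) (f (Suc k)) = of_int ((int k + 1) * (m - int k)) *s f k" for k
  proof (induction k)
    case 0
    show ?case
      using X_swap[OF r r(2) r(1), of v] T_f[of 0] E r
      by (simp add: f_0 f_Suc[of 0] T_def X_zero)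
  next
    case (Suc k)
    have "X p (p + 1) (f (Suc (Suc k))) = X (p + 1) p (X p (p + 1) (f (Suc k))) + T (f (Suc k))"
      using X_swap[OF r r(2) r(1), of "f (Suc k)"] by (simp add: f_Suc[of "Suc k"] T_def)
    also have "\<dots> = of_int ((int k + 1) * (m - int k)) *s f (Suc k) + of_int (m - 2 * int (Suc k)) *s f (Suc k)"
      unfolding Suc T_f using r by (simp only: X_scale f_Suc)
    also have "\<dots> = of_int ((int (Suc k) + 1) * (m - int (Suc k))) *s f (Suc k)"
      unfolding scale_left_distrib[symmetric] of_int_add[symmetric]
      by (simp add: algebra_simps)
    finally show ?case .
  qed
  have "f k \<noteq> 0" for k
  proof (induction k)
    case (Suc k)
    have "(int k + 1) * (m - int k) \<noteq> 0" using m by auto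
    then have "X p (p + 1) (f (Suc k)) \<noteq> 0" using E_f[of k] Suc by (simp only: scale_eq_0_iff of_int_eq_0_iff) simp
    then show ?case using X_zero[OF r] by metis
  qed (simp add: f_0 v)
  moreover have "inj (\<lambda>k. of_int (m - 2 * int k) :: complex)"
    by (auto intro!: injI simp: of_int_eq_iff simp del: of_int_diff of_int_mult)
  ultimately show False using no_infinite_eigenvalue_ladder[OF T_lin, of _ f] T_f by blast
qed

text \<open>The dominance order: \<open>\<nu>' - \<nu>\<close> is a nonnegative integral combination of simple roots. The partial
sums of \<open>\<nu>' - \<nu>\<close> are the coefficients of the simple roots.\<close>

definition dominates :: "(nat \<Rightarrow> int) \<Rightarrow> (nat \<Rightarrow> int) \<Rightarrow> bool" where
  "dominates \<nu>' \<nu> \<longleftrightarrow> (\<forall>m\<le>N. sum \<nu> {1..m} \<le> sum \<nu>' {1..m}) \<and> sum \<nu> {1..N} = sum \<nu>' {1..N}"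

lemma dominates_add_root:
  assumes "dominates \<nu>' \<nu>" "1 \<le> a" "a < b" "b \<le> N"
  shows "dominates (\<lambda>m. \<nu>' m + eps a m - eps b m) \<nu>"
  using assms by (auto simp: dominates_def eps_def sum.distrib sum_subtractf sum.delta' add_increasing2)

text \<open>\<open>(\<nu>', \<nu>' + 2\<rho>) - (\<nu>, \<nu> + 2\<rho>) = (\<nu>' - \<nu>, \<nu>' + \<nu> + 2\<rho>)\<close>. The second factor is strictly
dominant and the first is a nonnegative nonzero combination of simple roots; summation by parts
makes this visible.\<close>

lemma casimir_value_less:
  assumes dom: "\<And>i. 1 \<le> i \<Longrightarrow> i < N \<Longrightarrow> \<nu> (i + 1) \<le> \<nu> i" "\<And>i. 1 \<le> i \<Longrightarrow> i < N \<Longrightarrow> \<nu>' (i + 1) \<le> \<nu>' i"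
    and ge: "dominates \<nu>' \<nu>" and a: "a \<in> {1..<N}" "sum \<nu> {1..a} < sum \<nu>' {1..a}"
  shows "casimir_value \<nu> < casimir_value \<nu>'"
proof -
  define \<beta> where "\<beta> i = \<nu>' i - \<nu> i" for i
  define s where "s i = \<nu>' i + \<nu> i + int N + 1 - 2 * int i" for i
  have abel: "(\<Sum>i=1..M. \<beta> i * s i) = (\<Sum>i=1..<M. sum \<beta> {1..i} * (s i - s (Suc i))) + sum \<beta> {1..M} * s M"
    for M
  proof (induction M)
    case (Suc M)
    then show ?case
      by (cases "M = 0") (simp_all add: algebra_simps)
  qed simp
  have B: "sum \<beta> {Suc 0..m} = sum \<nu>' {Suc 0..m} - sum \<nu> {Suc 0..m}" for m
    by (simp add: \<beta>_def sum_subtractf)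
  have "casimir_value \<nu>' - casimir_value \<nu> = (\<Sum>i=1..N. \<beta> i * s i)"
    by (simp add: casimir_value_def sum_subtractf[symmetric] \<beta>_def s_def algebra_simps)
  also have "\<dots> = (\<Sum>i=1..<N. sum \<beta> {1..i} * (s i - s (Suc i)))"
    unfolding abel using ge by (simp add: B dominates_def)
  also have "\<dots> > 0"
  proof (rule sum_pos2[of _ a])
    have step: "s i - s (Suc i) > 0" if "i \<in> {1..<N}" for i
      using dom[of i] that by (simp add: s_def)
    show "0 < sum \<beta> {1..a} * (s a - s (Suc a))"
      using a step by (simp add: B)
    show "0 \<le> sum \<beta> {1..i} * (s i - s (Suc i))" if "i \<in> {1..<N}" for i
      using ge step[OF that] that by (simp add: B dominates_def)
  qed (use a in auto)
  finally show ?thesis by simp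
qed

text \<open>Simple raising operators are applied until they all vanish. This stops because each of them
raises the eigenvalue of \<open>T = - (\<Sum>i. i X\<^sub>i\<^sub>i)\<close> by one. The predicate \<open>R\<close> carries along a
property that raising preserves, below membership in an eigenspace of the Casimir operator.\<close>

lemma exists_highest_weight_vec:
  assumes w: "weight_vec \<nu> w" "w \<noteq> 0" "R w"
    and R: "\<And>u p. R u \<Longrightarrow> p \<in> {1..<N} \<Longrightarrow> R (X p (p + 1) u)"
  shows "\<exists>\<nu>' w'. w' \<noteq> 0 \<and> weight_vec \<nu>' w' \<and> R w' \<and> dominates \<nu>' \<nu>
    \<and> (\<forall>p\<in>{1..<N}. X p (p + 1) w' = 0)"
proof (rule ccontr)
  assume neg: "\<not> ?thesis"
  define ht where "ht \<xi> = (\<Sum>i=1..N. - int i * \<xi> i)" for \<xi> :: "nat \<Rightarrow> int"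
  define T where "T u = (\<Sum>i=1..N. of_int (- int i) *s X i i u)" for u
  have T_lin: "Vector_Spaces.linear scale scale T"
  proof (unfold_locales, goal_cases)
    case (1 x y)
    then show ?case
      by (simp add: T_def X_add scale_right_distrib sum.distrib[symmetric] del: of_int_minus)
  next
    case (2 c x)
    then show ?case by (simp add: T_def X_scale scale_sum_right mult.commute)
  qed
  have T_eig: "T u = of_int (ht \<xi>) *s u" if "weight_vec \<xi> u" for \<xi> u
    using that by (simp add: T_def ht_def weight_vec_def scale_sum_left)
  have "\<exists>\<nu>' w'. w' \<noteq> 0 \<and> weight_vec \<nu>' w' \<and> R w' \<and> dominates \<nu>' \<nu> \<and> ht \<nu>' = ht \<nu> + int k" for k
  proof (induction k)
    case 0
    have "dominates \<nu> \<nu>" by (simp add: dominates_def)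
    then show ?case using w by auto
  next
    case (Suc k)
    then obtain \<nu>' w' where *: "w' \<noteq> 0" "weight_vec \<nu>' w'" "R w'" "dominates \<nu>' \<nu>" "ht \<nu>' = ht \<nu> + int k"
      by blast
    then obtain p where p: "p \<in> {1..<N}" "X p (p + 1) w' \<noteq> 0" using neg by blast
    let ?\<nu> = "\<lambda>m. \<nu>' m + eps p m - eps (p + 1) m"
    have "ht ?\<nu> = ht \<nu>' + (\<Sum>i=1..N. (if i = p then - int i else 0)) - (\<Sum>i=1..N. (if i = p + 1 then - int i else 0))"
      unfolding ht_def sum.distrib[symmetric] sum_subtractf[symmetric]
      by (intro sum.cong) (auto simp: eps_def algebra_simps)
    also have "\<dots> = ht \<nu>' + 1" using p by simp
    finally have "ht ?\<nu> = ht \<nu> + int (Suc k)" using * by simp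
    moreover have "weight_vec ?\<nu> (X p (p + 1) w')" using * p by (intro weight_vec_X) auto
    moreover have "dominates ?\<nu> \<nu>" using * p by (intro dominates_add_root) auto
    ultimately show ?case using p R[OF \<open>R w'\<close> p(1)] by blast
  qed
  then obtain g h where gh: "\<And>k. h k \<noteq> 0" "\<And>k. weight_vec (g k) (h k)" "\<And>k. ht (g k) = ht \<nu> + int k"
    by metis
  have "T (h k) = of_int (ht \<nu> + int k) *s h k" for k using T_eig[OF gh(2)] gh(3) by simp
  moreover have "inj (\<lambda>k. of_int (ht \<nu> + int k) :: complex)"
    by (auto intro!: injI simp: of_int_eq_iff simp del: of_int_add)
  ultimately show False using no_infinite_eigenvalue_ladder[OF T_lin, of _ h] gh(1) by blast
qed

text \<open>An eigenvector \<open>w\<close> of weight \<open>\<nu> + \<epsilon>\<^sub>a - \<epsilon>\<^sub>b\<close> with the Casimir value of \<open>\<nu>\<close> would yield, after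
raising, a highest weight vector whose weight lies strictly above \<open>\<nu>\<close> and has the same Casimir value.\<close>

lemma casimir_no_eigenvector_above:
  assumes v: "weight_vec \<nu> v" "v \<noteq> 0" "\<And>p. p \<in> {1..<N} \<Longrightarrow> X p (p + 1) v = 0"
    and ab: "1 \<le> a" "a < b" "b \<le> N"
    and w: "weight_vec (\<lambda>m. \<nu> m + eps a m - eps b m) w" "casimir w = of_int (casimir_value \<nu>) *s w"
  shows "w = 0"
proof (rule ccontr)
  assume "w \<noteq> 0"
  let ?\<xi> = "\<lambda>m. \<nu> m + eps a m - eps b m"
  have "\<exists>\<nu>' w'. w' \<noteq> 0 \<and> weight_vec \<nu>' w' \<and> casimir w' = of_int (casimir_value \<nu>) *s w'
      \<and> dominates \<nu>' ?\<xi> \<and> (\<forall>p\<in>{1..<N}. X p (p + 1) w' = 0)"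
    using w \<open>w \<noteq> 0\<close> by (intro exists_highest_weight_vec) (auto simp: casimir_commutes X_scale)
  then obtain \<nu>' w' where *: "w' \<noteq> 0" "weight_vec \<nu>' w'" "casimir w' = of_int (casimir_value \<nu>) *s w'"
    "dominates \<nu>' ?\<xi>" "\<And>p. p \<in> {1..<N} \<Longrightarrow> X p (p + 1) w' = 0" by blast
  have "X i j w' = 0" if "1 \<le> i" "i < j" "j \<le> N" for i j
    using raising_from_simple[of w' i j] * that by blast
  then have "(\<Sum>i=1..N. \<Sum>j=1..N. if i < j then X j i (X i j w') else 0) = 0"
    by (intro sum.neutral ballI) (auto simp: X_zero)
  then have "casimir w' = of_int (casimir_value \<nu>') *s w'"
    using casimir_on_weight_vec[OF *(2)] by simp
  then have "casimir_value \<nu>' = casimir_value \<nu>" using * by (simp add: scale_right_imp_eq)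
  moreover have "casimir_value \<nu> < casimir_value \<nu>'"
  proof (rule casimir_value_less)
    have root: "sum ?\<xi> {1..m} = sum \<nu> {1..m} + (if a \<le> m \<and> m < b then 1 else 0)" for m
      using ab by (auto simp: eps_def sum.distrib sum_subtractf sum.delta')
    show "dominates \<nu>' \<nu>" unfolding dominates_def
    proof (intro conjI allI impI)
      fix m assume "m \<le> N"
      then have "sum ?\<xi> {1..m} \<le> sum \<nu>' {1..m}" using *(4) by (simp only: dominates_def)
      then show "sum \<nu> {1..m} \<le> sum \<nu>' {1..m}" unfolding root by (auto split: if_splits)
    next
      have "sum ?\<xi> {1..N} = sum \<nu>' {1..N}" using *(4) by (simp only: dominates_def)
      then show "sum \<nu> {1..N} = sum \<nu>' {1..N}" unfolding root using ab by simp
    qed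
    have "sum ?\<xi> {1..a} \<le> sum \<nu>' {1..a}" using *(4) ab by (simp only: dominates_def)
    then show "sum \<nu> {1..a} < sum \<nu>' {1..a}" unfolding root using ab by simp
    show "a \<in> {1..<N}" using ab by simp
  qed (use v * highest_weight_dominant in auto)
  ultimately show False by simp
qed

text \<open>The part of weight \<open>\<nu>\<close> of the sum of the images of the lowering operators. Requiring each
summand to come from a weight vector spares the decomposition of the module into weight spaces.\<close>

definition lowered :: "(nat \<Rightarrow> int) \<Rightarrow> 'v set" where
  "lowered \<nu> = span {X b a w | a b w. 1 \<le> a \<and> a < b \<and> b \<le> N
      \<and> weight_vec (\<lambda>m. \<nu> m + eps a m - eps b m) w}"

text \<open>Let \<open>T\<close> be the Casimir operator minus its value at \<open>\<nu>\<close>. It is injective, hence bijective, on the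
weight spaces \<open>\<nu> + \<epsilon>\<^sub>a - \<epsilon>\<^sub>b\<close> with \<open>a < b\<close>, so \<open>u = T u'\<close> for some \<open>u'\<close> of weight \<open>\<nu>\<close>. The raising
operators commute with \<open>T\<close> and kill \<open>u\<close>, so \<open>T\<close> kills the raised vectors \<open>X\<^sub>i\<^sub>j u'\<close>, which therefore
vanish. But on weight \<open>\<nu>\<close> the operator \<open>T\<close> is \<open>2 \<Sum> X\<^sub>j\<^sub>i X\<^sub>i\<^sub>j\<close>, so \<open>u = T u' = 0\<close>.\<close>

theorem highest_weight_vec_not_lowered:
  assumes u: "u \<in> lowered \<nu>" "weight_vec \<nu> u" "\<And>p. p \<in> {1..<N} \<Longrightarrow> X p (p + 1) u = 0"
  shows "u = 0"
proof (rule ccontr)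
  assume nz: "u \<noteq> 0"
  define T where "T w = casimir w - of_int (casimir_value \<nu>) *s w" for w
  interpret c: Vector_Spaces.linear scale scale casimir by (rule casimir_linear)
  have T_lin: "Vector_Spaces.linear scale scale T"
    by unfold_locales (simp_all add: T_def c.add c.scale scale_right_distrib scale_right_diff_distrib scale_left_commute)
  interpret T: Vector_Spaces.linear scale scale T by (rule T_lin)
  have T_X: "T (X i j w) = X i j (T w)" if "i \<in> {1..N}" "j \<in> {1..N}" for i j w
    using that by (simp add: T_def casimir_commutes X_diff X_scale)
  have T_weight: "weight_vec \<xi> (T w)" if "weight_vec \<xi> w" for \<xi> w
    using subspace_diff[OF weight_vec_subspace, of "casimir w" \<xi> "of_int (casimir_value \<nu>) *s w"]
      subspace_scale[OF weight_vec_subspace, of w \<xi>] casimir_weight_vec[OF that] that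
    by (simp add: T_def)
  have T_inj: "w = 0"
    if "1 \<le> a" "a < b" "b \<le> N" "weight_vec (\<lambda>m. \<nu> m + eps a m - eps b m) w" "T w = 0" for a b w
    using casimir_no_eigenvector_above[OF u(2) nz u(3) that(1-4)] that(5) by (simp add: T_def)
  have "\<exists>u'. weight_vec \<nu> u' \<and> T u' = u"
    using u(1) unfolding lowered_def
  proof (induction rule: span_induct_alt)
    case base
    show ?case using subspace_0[OF weight_vec_subspace] by (intro exI[of _ 0]) simp
  next
    case (step c x y)
    then obtain a b w where ab: "1 \<le> a" "a < b" "b \<le> N" and x: "x = X b a w"
      and w: "weight_vec (\<lambda>m. \<nu> m + eps a m - eps b m) w" by blast
    have "\<exists>w'\<in>{w'. weight_vec (\<lambda>m. \<nu> m + eps a m - eps b m) w'}. T w' = w"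
      using T_weight T_inj[OF ab] w
      by (intro injective_on_subspace_imp_surjective[OF T_lin weight_vec_subspace]) blast+
    then obtain w' where w': "weight_vec (\<lambda>m. \<nu> m + eps a m - eps b m) w'" "T w' = w" by blast
    from step obtain y' where y': "weight_vec \<nu> y'" "T y' = y" by blast
    have "weight_vec (\<lambda>m. (\<nu> m + eps a m - eps b m) + eps b m - eps a m) (X b a w')"
      using w' ab by (intro weight_vec_X) auto
    then have "weight_vec \<nu> (X b a w')" by simp
    then have "weight_vec \<nu> (c *s X b a w' + y')"
      using subspace_add[OF weight_vec_subspace] subspace_scale[OF weight_vec_subspace] y' by simp
    moreover have "T (c *s X b a w' + y') = c *s x + y"
      using ab w' y' x by (simp add: T.add T.scale T_X)
    ultimately show ?case by blast
  qed
  then obtain u' where u': "weight_vec \<nu> u'" "T u' = u" by blast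
  have raise0: "X i j u = 0" if "1 \<le> i" "i < j" "j \<le> N" for i j
    using raising_from_simple[of u i j] u that by blast
  have T_formula: "T w = 2 *s (\<Sum>i=1..N. \<Sum>j=1..N. if i < j then X j i (X i j w) else 0)"
    if "weight_vec \<nu> w" for w
    using casimir_on_weight_vec[OF that] by (simp add: T_def)
  have "X i j u' = 0" if ij: "1 \<le> i" "i < j" "j \<le> N" for i j
  proof -
    have "weight_vec (\<lambda>m. \<nu> m + eps i m - eps j m) (X i j u')"
      using u' ij by (intro weight_vec_X) auto
    moreover have "T (X i j u') = 0" using raise0[OF ij] u' ij by (simp add: T_X)
    ultimately show ?thesis using T_inj[OF ij] by blast
  qed
  then have "T u' = 0"
    unfolding T_formula[OF u'(1)] by (simp add: X_zero cong: if_cong)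
  then show False using u' nz by simp
qed

end


definition shift_weight :: "nat \<Rightarrow> nat \<Rightarrow> weight \<Rightarrow> weight" where
  "shift_weight n i \<mu> = (\<lambda>j. \<mu> j + fund_weight n i j - fund_weight n (i-1) j)"


section \<open>Matrix units and translations acting on a module\<close>

context aff_module
begin

notation scale (infixr \<open>*s\<close> 75)

text \<open>The matrix unit \<open>A\<^sub>i\<^sub>,\<^sub>j\<close> projected to trace zero. The identity matrix being central, this
projection is a homomorphism from \<open>gl(n+1)\<close> onto \<open>sl(n+1)\<close>, so the projected units still satisfy the relations of
\<open>gl(n+1)\<close>.\<close>

definition sl_unit :: "nat \<Rightarrow> nat \<Rightarrow> aff" where
  "sl_unit i j = of_sl n (mat (n+1) (n+1) (\<lambda>(r, c).
     (if Suc r = i \<and> Suc c = j then 1 else 0) - (if i = j \<and> r = c then 1 / of_nat (n+1) else 0)))"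

definition A :: "nat \<Rightarrow> nat \<Rightarrow> 'v \<Rightarrow> 'v" where "A i j = rho (sl_unit i j)"

definition P :: "nat \<Rightarrow> 'v \<Rightarrow> 'v" where "P k = rho (elP n k)"

lemma sl_unit_carrier:
  assumes "i \<in> {1..n+1}" "j \<in> {1..n+1}"
  shows "sl_unit i j \<in> aff_carrier n"
proof -
  have "(\<Sum>r<n+1. (if Suc r = i \<and> Suc r = j then 1 else 0)
      - (if i = j then 1 / of_nat (n+1) else 0)) = (0 :: complex)"
  proof (cases "i = j")
    case True
    have "(\<Sum>r<n+1. if Suc r = i then 1 else 0) = (\<Sum>r<n+1. if r = i - 1 then 1 else (0 :: complex))"
      using assms by (intro sum.cong) auto
    also have "\<dots> = 1" using assms by (auto simp: sum.delta)
    finally show ?thesis using True by (simp add: sum_subtractf del: sum.lessThan_Suc of_nat_Suc)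
  next
    case False
    then show ?thesis by (intro sum.neutral) auto
  qed
  then show ?thesis
    by (auto simp: sl_unit_def of_sl_def aff_carrier_def sl_carrier_def simp del: sum.lessThan_Suc)
qed

lemma elP_carrier: "elP n k \<in> aff_carrier n"
  by (auto simp: elP_def aff_carrier_def sl_carrier_def)

lemma aff_smult_carrier: "x \<in> aff_carrier n \<Longrightarrow> aff_smult c x \<in> aff_carrier n"
  by (auto simp: aff_smult_def aff_carrier_def sl_carrier_def sum_distrib_left[symmetric]
      simp del: sum.lessThan_Suc)

lemma rho_combination:
  assumes "x \<in> aff_carrier n" "y \<in> aff_carrier n"
  shows "rho (aff_add (aff_smult a x) (aff_smult b y)) w = a *s rho x w + b *s rho y w"
  using assms by (simp add: rho_add rho_smult aff_smult_carrier)

text \<open>The multiples of the identity drop out of both sides: on the left because they are central, on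
the right because \<open>j = k\<close> and \<open>l = i\<close> produce the same trace with opposite signs.\<close>

lemma sl_unit_bracket:
  assumes ij: "i \<in> {1..n+1}" "j \<in> {1..n+1}" and kl: "k \<in> {1..n+1}" "l \<in> {1..n+1}"
  shows "aff_bracket (sl_unit i j) (sl_unit k l)
    = aff_add (aff_smult (if j = k then 1 else 0) (sl_unit i l)) (aff_smult (if l = i then -1 else 0) (sl_unit k j))"
proof -
  \<comment> \<open>The projected unit is a rank one matrix minus a scalar matrix, entrywise \<open>e i r * e j c - s i j * d r c\<close>.\<close>
  define e where "e i r = (if Suc r = i then 1 else 0 :: complex)" for i r
  define s where "s i j = (if i = j then 1 / of_nat (n+1) else 0 :: complex)" for i j :: nat
  define d where "d r c = (if r = c then 1 else 0 :: complex)" for r c :: nat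
  define M where "M i j = mat (n+1) (n+1) (\<lambda>(r, c). e i r * e j c - s i j * d r c)" for i j
  have unit: "sl_unit i j = of_sl n (M i j)" for i j
    unfolding sl_unit_def M_def by (intro arg_cong[of _ _ "of_sl n"] eq_matI) (auto simp: e_def s_def d_def)
  have prod: "(\<Sum>t\<in>{0..<n+1}. (e i r * e j t - s i j * d r t) * (e k t * e l c - s k l * d t c))
     = (if j = k then e i r * e l c else 0) - s k l * (e i r * e j c) - s i j * (e k r * e l c) + s i j * s k l * d r c"
    if j: "j \<in> {1..n+1}" "k \<in> {1..n+1}" and rc: "r < n+1" "c < n+1" for i j k l r c
  proof -
    have "(\<Sum>t\<in>{0..<n+1}. (e i r * e j t - s i j * d r t) * (e k t * e l c - s k l * d t c))
      = e i r * e l c * (\<Sum>t\<in>{0..<n+1}. e j t * e k t) - s k l * e i r * (\<Sum>t\<in>{0..<n+1}. e j t * d t c)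
        - s i j * e l c * (\<Sum>t\<in>{0..<n+1}. d r t * e k t) + s i j * s k l * (\<Sum>t\<in>{0..<n+1}. d r t * d t c)"
      unfolding sum_distrib_left sum_subtractf[symmetric] sum.distrib[symmetric]
      by (intro sum.cong) (auto simp: algebra_simps)
    also have "(\<Sum>t\<in>{0..<n+1}. e j t * e k t) = (\<Sum>t\<in>{0..<n+1}. if t = j - 1 then (if j = k then 1 else 0) else 0)"
      using j by (intro sum.cong) (auto simp: e_def)
    also have "\<dots> = (if j = k then 1 else 0)"
      using j by (subst sum.delta) auto
    also have "(\<Sum>t\<in>{0..<n+1}. e j t * d t c) = (\<Sum>t\<in>{0..<n+1}. if t = c then e j c else 0)"
      by (intro sum.cong) (auto simp: d_def)
    also have "\<dots> = e j c" using rc by (subst sum.delta) auto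
    also have "(\<Sum>t\<in>{0..<n+1}. d r t * e k t) = (\<Sum>t\<in>{0..<n+1}. if t = r then e k r else 0)"
      by (intro sum.cong) (auto simp: d_def)
    also have "\<dots> = e k r" using rc by (subst sum.delta) auto
    also have "(\<Sum>t\<in>{0..<n+1}. d r t * d t c) = (\<Sum>t\<in>{0..<n+1}. if t = r then d r c else 0)"
      by (intro sum.cong) (auto simp: d_def)
    also have "\<dots> = d r c" using rc by (subst sum.delta) auto
    finally show ?thesis by simp
  qed
  have "M i j * M k l - M k l * M i j
      = (if j = k then 1 else 0) \<cdot>\<^sub>m M i l + (if l = i then -1 else 0) \<cdot>\<^sub>m M k j"
  proof (rule eq_matI)
    fix r c
    assume "r < dim_row ((if j = k then 1 else 0) \<cdot>\<^sub>m M i l + (if l = i then -1 else 0) \<cdot>\<^sub>m M k j)"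
      "c < dim_col ((if j = k then 1 else 0) \<cdot>\<^sub>m M i l + (if l = i then -1 else 0) \<cdot>\<^sub>m M k j)"
    then have rc: "r < n+1" "c < n+1" by (auto simp: M_def)
    have pq: "(M i j * M k l) $$ (r, c) = (\<Sum>t\<in>{0..<n+1}. (e i r * e j t - s i j * d r t) * (e k t * e l c - s k l * d t c))"
      "(M k l * M i j) $$ (r, c) = (\<Sum>t\<in>{0..<n+1}. (e k r * e l t - s k l * d r t) * (e i t * e j c - s i j * d t c))"
      using rc by (simp_all add: M_def scalar_prod_def del: sum.op_ivl_Suc)
    have "(M i j * M k l - M k l * M i j) $$ (r, c) = (M i j * M k l) $$ (r, c) - (M k l * M i j) $$ (r, c)"
      using rc by (intro index_minus_mat) (simp_all add: M_def)
    also have "\<dots> = (if j = k then e i r * e l c else 0) - (if l = i then e k r * e j c else 0)"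
      unfolding pq prod[OF ij(2) kl(1) rc] prod[OF kl(2) ij(1) rc] by (simp add: algebra_simps)
    also have "\<dots> = ((if j = k then 1 else 0) \<cdot>\<^sub>m M i l + (if l = i then -1 else 0) \<cdot>\<^sub>m M k j) $$ (r, c)"
      using rc by (auto simp: M_def s_def)
    finally show "(M i j * M k l - M k l * M i j) $$ (r, c)
        = ((if j = k then 1 else 0) \<cdot>\<^sub>m M i l + (if l = i then -1 else 0) \<cdot>\<^sub>m M k j) $$ (r, c)" .
  qed (simp_all add: M_def)
  moreover have "M i j *\<^sub>v 0\<^sub>v (n+1) = 0\<^sub>v (n+1)" for i j
    by (auto simp: M_def)
  ultimately show ?thesis
    unfolding unit by (auto simp: aff_bracket_def of_sl_def aff_add_def aff_smult_def)
qed

lemma sl_unit_bracket_P: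
  assumes ij: "i \<in> {1..n+1}" "j \<in> {1..n+1}" and k: "k \<in> {1..n+1}"
  shows "aff_bracket (sl_unit i j) (elP n k)
    = aff_add (aff_smult (if j = k then 1 else 0) (elP n i)) (aff_smult (if i = j then - 1 / of_nat (n+1) else 0) (elP n k))"
proof -
  let ?M = "mat (n+1) (n+1) (\<lambda>(r, c).
     (if Suc r = i \<and> Suc c = j then 1 else 0) - (if i = j \<and> r = c then 1 / of_nat (n+1) else 0 :: complex))"
  let ?e = "\<lambda>k. vec (n+1) (\<lambda>r. if Suc r = k then 1 else 0 :: complex)"
  have "?M *\<^sub>v ?e k = (if j = k then 1 else 0) \<cdot>\<^sub>v ?e i + (if i = j then - 1 / of_nat (n+1) else 0) \<cdot>\<^sub>v ?e k"
  proof (rule eq_vecI)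
    fix r assume "r < dim_vec ((if j = k then 1 else 0) \<cdot>\<^sub>v ?e i + (if i = j then - 1 / of_nat (n+1) else 0) \<cdot>\<^sub>v ?e k)"
    then have r: "r < n+1" by simp
    have "(?M *\<^sub>v ?e k) $ r = (\<Sum>c\<in>{0..<n+1}. ((if Suc r = i \<and> Suc c = j then 1 else 0)
        - (if i = j \<and> r = c then 1 / of_nat (n+1) else 0)) * (if Suc c = k then 1 else 0))"
      using r by (simp add: scalar_prod_def del: sum.op_ivl_Suc)
    also have "\<dots> = (\<Sum>c\<in>{0..<n+1}. if c = k - 1 then (if Suc r = i \<and> k = j then 1 else 0)
        - (if i = j \<and> Suc r = k then 1 / of_nat (n+1) else 0) else 0)"
      using k by (intro sum.cong) auto
    also have "\<dots> = (if Suc r = i \<and> k = j then 1 else 0)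
        - (if i = j \<and> Suc r = k then 1 / of_nat (n+1) else 0)"
      using k by (subst sum.delta) auto
    also have "\<dots> = ((if j = k then 1 else 0) \<cdot>\<^sub>v ?e i + (if i = j then - 1 / of_nat (n+1) else 0) \<cdot>\<^sub>v ?e k) $ r"
      using r by auto
    finally show "(?M *\<^sub>v ?e k) $ r
      = ((if j = k then 1 else 0) \<cdot>\<^sub>v ?e i + (if i = j then - 1 / of_nat (n+1) else 0) \<cdot>\<^sub>v ?e k) $ r" .
  qed simp
  then show ?thesis
    by (auto simp: sl_unit_def aff_bracket_def of_sl_def elP_def aff_add_def aff_smult_def)
qed

lemma
  assumes "i \<in> {1..n+1}" "j \<in> {1..n+1}"
  shows A_add: "A i j (u + w) = A i j u + A i j w"
    and A_diff: "A i j (u - w) = A i j u - A i j w"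
    and A_scale: "A i j (c *s w) = c *s A i j w"
    and A_zero: "A i j 0 = 0"
    and A_sum: "A i j (sum f I) = (\<Sum>a\<in>I. A i j (f a))"
proof -
  have *: "Vector_Spaces.linear scale scale (A i j)"
    unfolding A_def using assms by (intro rho_linear sl_unit_carrier)
  interpret l: Vector_Spaces.linear scale scale "A i j" by (rule *)
  show "A i j (u + w) = A i j u + A i j w" "A i j (u - w) = A i j u - A i j w"
    "A i j (c *s w) = c *s A i j w" "A i j 0 = 0" "A i j (sum f I) = (\<Sum>a\<in>I. A i j (f a))"
    by (simp_all add: l.add l.diff l.scale l.sum)
qed

lemma
  shows P_add: "P k (u + w) = P k u + P k w"
    and P_diff: "P k (u - w) = P k u - P k w"
    and P_scale: "P k (c *s w) = c *s P k w"
    and P_zero: "P k 0 = 0"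
    and P_sum: "P k (sum f I) = (\<Sum>a\<in>I. P k (f a))"
proof -
  have *: "Vector_Spaces.linear scale scale (P k)"
    unfolding P_def by (intro rho_linear elP_carrier)
  interpret l: Vector_Spaces.linear scale scale "P k" by (rule *)
  show "P k (u + w) = P k u + P k w" "P k (u - w) = P k u - P k w"
    "P k (c *s w) = c *s P k w" "P k 0 = 0" "P k (sum f I) = (\<Sum>a\<in>I. P k (f a))"
    by (simp_all add: l.add l.diff l.scale l.sum)
qed

lemma A_swap:
  assumes "i \<in> {1..n+1}" "j \<in> {1..n+1}" "k \<in> {1..n+1}" "l \<in> {1..n+1}"
  shows "A i j (A k l w) = A k l (A i j w)
    + ((if j = k then A i l w else 0) - (if l = i then A k j w else 0))"
proof -
  have "A i j (A k l w) - A k l (A i j w) = rho (aff_bracket (sl_unit i j) (sl_unit k l)) w"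
    using assms by (simp add: A_def rho_bracket sl_unit_carrier)
  also have "\<dots> = (if j = k then A i l w else 0) - (if l = i then A k j w else 0)"
    using assms by (simp add: sl_unit_bracket rho_combination sl_unit_carrier A_def)
  finally show ?thesis by (simp add: algebra_simps)
qed

lemma A_P_swap:
  assumes "i \<in> {1..n+1}" "j \<in> {1..n+1}" "k \<in> {1..n+1}"
  shows "A i j (P k w) = P k (A i j w)
    + ((if j = k then P i w else 0) - (if i = j then (1 / of_nat (n+1)) *s P k w else 0))"
proof -
  have "A i j (P k w) - P k (A i j w) = rho (aff_bracket (sl_unit i j) (elP n k)) w"
    using assms by (simp add: A_def P_def rho_bracket sl_unit_carrier elP_carrier)
  also have "\<dots> = (if j = k then P i w else 0) - (if i = j then (1 / of_nat (n+1)) *s P k w else 0)"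
    using assms by (simp add: sl_unit_bracket_P rho_combination elP_carrier P_def)
  finally show ?thesis by (simp add: algebra_simps)
qed

lemma P_swap: "P j (P k w) = P k (P j w)"
proof -
  have "aff_bracket (elP n j) (elP n k) = aff_smult 0 (elP n j)"
    by (auto simp: aff_bracket_def elP_def aff_smult_def)
  then have "P j (P k w) - P k (P j w) = rho (aff_smult 0 (elP n j)) w"
    by (metis P_def rho_bracket elP_carrier)
  then show ?thesis by (simp add: rho_smult elP_carrier)
qed

text \<open>The partial sums of the projected diagonal units are the diagonal matrices in \<open>D\<close>, the last of
which is zero.\<close>

lemma A_trace: "(\<Sum>i=1..n+1. A i i w) = 0"
proof -
  define D where "D m = of_sl n (mat (n+1) (n+1) (\<lambda>(r, c).
     if r = c then (if r < m then 1 else 0) - of_nat m / of_nat (n+1) else 0))" for m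
  have D_carrier: "D m \<in> aff_carrier n" if "m \<le> n+1" for m
  proof -
    have "{..<n+1} \<inter> {r. r < m} = {..<m}" using that by auto
    then have "(\<Sum>r<n+1. (if r < m then 1 else 0) - of_nat m / of_nat (n+1)) = (0::complex)"
      by (simp add: sum_subtractf sum.If_cases del: sum.lessThan_Suc of_nat_Suc)
    then show ?thesis
      by (auto simp: D_def of_sl_def aff_carrier_def sl_carrier_def simp del: sum.lessThan_Suc)
  qed
  have "(\<Sum>i=1..m. A i i w) = rho (D m) w" if "m \<le> n+1" for m
    using that
  proof (induction m)
    case 0
    have "D 0 = aff_smult 0 (D 0)" by (auto simp: D_def of_sl_def aff_smult_def)
    then have "rho (D 0) w = 0 *s rho (D 0) w" using rho_smult[OF D_carrier[of 0], of 0 w] by simp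
    then show ?case by simp
  next
    case (Suc m)
    have "D (Suc m) = aff_add (D m) (sl_unit (Suc m) (Suc m))"
      by (auto simp: D_def of_sl_def sl_unit_def aff_add_def add_divide_distrib less_Suc_eq)
    then show ?case
      using Suc by (simp add: rho_add D_carrier sl_unit_carrier A_def)
  qed
  then have "(\<Sum>i=1..n+1. A i i w) = rho (D (n+1)) w" by blast
  moreover have "D (n+1) = aff_smult 0 (D (n+1))"
    using of_nat_neq_0[of n, where 'a = complex]
    by (auto simp: D_def of_sl_def aff_smult_def intro!: eq_matI simp del: of_nat_Suc)
  then have "rho (D (n+1)) w = 0 *s rho (D (n+1)) w"
    using rho_smult[OF D_carrier[of "n+1"], of 0 w] by simp
  ultimately show ?thesis by simp
qed

lemma rho_elE: "p \<le> q \<Longrightarrow> rho (elE n p q) = A p (q + 1)"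
  by (auto simp: A_def elE_def sl_unit_def mat_unit_def of_sl_def intro!: arg_cong[of _ _ rho])

lemma rho_elH:
  assumes "i \<in> {1..n}"
  shows "rho (elH n i) w = A i i w - A (i + 1) (i + 1) w"
proof -
  have "elH n i = aff_add (aff_smult 1 (sl_unit i i)) (aff_smult (-1) (sl_unit (i + 1) (i + 1)))"
    by (auto simp: elH_def mat_unit_def of_sl_def sl_unit_def aff_add_def aff_smult_def)
  then show ?thesis using assms by (simp add: rho_combination sl_unit_carrier A_def)
qed


section \<open>Weight vectors and images of lowering operators\<close>

text \<open>The family \<open>\<nu>\<close> represents the \<open>sl(n+1)\<close>-weight \<open>\<nu>\<^sub>1 \<epsilon>\<^sub>1 + \<dots> + \<nu>\<^sub>n\<^sub>+\<^sub>1 \<epsilon>\<^sub>n\<^sub>+\<^sub>1\<close>, which determines it up to a constant.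
Subtracting the mean removes this ambiguity in accordance with the projection to trace zero,
while the coordinates stay integral and \<open>P\<^sub>k\<close> simply adds \<open>\<epsilon>\<^sub>k\<close>.\<close>

definition mean :: "(nat \<Rightarrow> int) \<Rightarrow> complex" where
  "mean \<nu> = of_int (sum \<nu> {1..n+1}) / of_nat (n+1)"

definition wt :: "(nat \<Rightarrow> int) \<Rightarrow> 'v \<Rightarrow> bool" where
  "wt \<nu> w \<longleftrightarrow> (\<forall>i\<in>{1..n+1}. A i i w = (of_int (\<nu> i) - mean \<nu>) *s w)"

lemma sum_eps: "i \<in> {1..n+1} \<Longrightarrow> sum (eps i) {1..n+1} = 1"
  by (simp add: eps_def sum.delta del: sum.cl_ivl_Suc)

lemma mean_root:
  assumes "i \<in> {1..n+1}" "j \<in> {1..n+1}"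
  shows "mean (\<lambda>m. \<nu> m + eps i m - eps j m) = mean \<nu>"
proof -
  have "sum (\<lambda>m. \<nu> m + eps i m - eps j m) {1..n+1} = sum \<nu> {1..n+1}"
    unfolding sum.distrib sum_subtractf sum_eps[OF assms(1)] sum_eps[OF assms(2)] by simp
  then show ?thesis by (simp only: mean_def)
qed

lemma mean_eps:
  assumes "k \<in> {1..n+1}"
  shows "mean (\<lambda>m. \<nu> m + eps k m) = mean \<nu> + 1 / of_nat (n+1)"
proof -
  have "sum (\<lambda>m. \<nu> m + eps k m) {1..n+1} = sum \<nu> {1..n+1} + 1"
    unfolding sum.distrib sum_eps[OF assms] by simp
  then show ?thesis by (simp only: mean_def of_int_add of_int_1 add_divide_distrib)
qed

lemma wt_subspace: "subspace {w. wt \<nu> w}"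
  unfolding subspace_def wt_def
  by (auto simp: A_add A_scale A_zero scale_right_distrib scale_left_commute)

lemma wt_diff: "wt \<nu> u \<Longrightarrow> wt \<nu> w \<Longrightarrow> wt \<nu> (u - w)"
  and wt_scale: "wt \<nu> w \<Longrightarrow> wt \<nu> (c *s w)"
  and wt_sum: "(\<And>i. i \<in> I \<Longrightarrow> wt \<nu> (f i)) \<Longrightarrow> wt \<nu> (sum f I)"
  using subspace_diff[OF wt_subspace] subspace_scale[OF wt_subspace]
    subspace_sum[OF wt_subspace, of I f \<nu>] by auto

lemma wt_A:
  assumes "wt \<nu> w" "i \<in> {1..n+1}" "j \<in> {1..n+1}"
  shows "wt (\<lambda>m. \<nu> m + eps i m - eps j m) (A i j w)"
  unfolding wt_def mean_root[OF assms(2,3)]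
proof
  fix m assume m: "m \<in> {1..n+1}"
  have "A m m (A i j w) = A i j (A m m w) + ((if m = i then A m j w else 0) - (if j = m then A i m w else 0))"
    by (rule A_swap[OF m m assms(2,3)])
  also have "\<dots> = (of_int (\<nu> m + eps i m - eps j m) - mean \<nu>) *s A i j w"
    using assms m
    by (auto simp: wt_def A_scale A_diff eps_def scale_left_diff_distrib scale_left_distrib)
  finally show "A m m (A i j w) = (of_int (\<nu> m + eps i m - eps j m) - mean \<nu>) *s A i j w" .
qed

lemma wt_P:
  assumes "wt \<nu> w" "k \<in> {1..n+1}"
  shows "wt (\<lambda>m. \<nu> m + eps k m) (P k w)"
  unfolding wt_def mean_eps[OF assms(2)]
proof
  fix m assume m: "m \<in> {1..n+1}"
  have "A m m (P k w) = P k (A m m w) + ((if m = k then P m w else 0) - (1 / of_nat (n+1)) *s P k w)"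
    using A_P_swap[OF m m assms(2)] by simp
  also have "\<dots> = (of_int (\<nu> m + eps k m) - (mean \<nu> + 1 / of_nat (n+1))) *s P k w"
    using assms m by (auto simp: wt_def P_scale P_diff eps_def scale_left_diff_distrib scale_left_distrib
        simp del: of_nat_add of_nat_Suc)
  finally show "A m m (P k w) = (of_int (\<nu> m + eps k m) - (mean \<nu> + 1 / of_nat (n+1))) *s P k w" .
qed

lemma wt_cong: "wt \<nu> w \<Longrightarrow> \<nu> = \<nu>' \<Longrightarrow> wt \<nu>' w"
  by simp

lemma wt_coroot:
  assumes "wt \<nu> w" "i \<in> {1..n}"
  shows "A i i w - A (i + 1) (i + 1) w = of_int (\<nu> i - \<nu> (i + 1)) *s w"
  using assms by (simp add: wt_def scale_left_diff_distrib)

text \<open>The identity of \<open>gl(n+1)\<close> may act by any scalar. With the scalar \<open>mean \<nu>\<close>, vectors of weight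
\<open>\<nu>\<close>, and of all weights with the same coordinate sum, get the integral eigenvalues of a \<open>gl(n+1)\<close>-weight.\<close>

lemma shifted_gl_module:
  "gl_module scale Basis (n+1) (\<lambda>i j w. A i j w + (if i = j then c *s w else 0))"
proof (intro gl_module.intro gl_module_axioms.intro)
  show "finite_dimensional_vector_space scale Basis" by (rule finite_dimensional_vector_space_axioms)
next
  fix i j assume ij: "i \<in> {1..n+1}" "j \<in> {1..n+1}"
  show "Vector_Spaces.linear scale scale (\<lambda>w. A i j w + (if i = j then c *s w else 0))"
    using ij by unfold_locales (auto simp: A_add A_scale scale_right_distrib scale_left_commute)
next
  fix i j k l w assume *: "i \<in> {1..n+1}" "j \<in> {1..n+1}" "k \<in> {1..n+1}" "l \<in> {1..n+1}"
  let ?X = "\<lambda>i j w. A i j w + (if i = j then c *s w else 0)"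
  have "?X i j (?X k l w) - ?X k l (?X i j w) = A i j (A k l w) - A k l (A i j w)"
    using * by (auto simp: A_add A_scale A_zero scale_right_distrib)
  also have "\<dots> = (if j = k then ?X i l w else 0) - (if l = i then ?X k j w else 0)"
    using A_swap[OF *, of w] by auto
  finally show "?X i j (?X k l w) - ?X k l (?X i j w)
    = (if j = k then ?X i l w else 0) - (if l = i then ?X k j w else 0)" .
qed

definition low :: "(nat \<Rightarrow> int) \<Rightarrow> 'v set" where
  "low \<nu> = span {A b a w | a b w. 1 \<le> a \<and> a < b \<and> b \<le> n+1
      \<and> wt (\<lambda>m. \<nu> m + eps a m - eps b m) w}"

lemma low_add: "u \<in> low \<nu> \<Longrightarrow> w \<in> low \<nu> \<Longrightarrow> u + w \<in> low \<nu>"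
  and low_diff: "u \<in> low \<nu> \<Longrightarrow> w \<in> low \<nu> \<Longrightarrow> u - w \<in> low \<nu>"
  and low_scale: "w \<in> low \<nu> \<Longrightarrow> c *s w \<in> low \<nu>"
  and low_sum: "(\<And>i. i \<in> I \<Longrightarrow> f i \<in> low \<nu>) \<Longrightarrow> sum f I \<in> low \<nu>"
  and low_zero: "0 \<in> low \<nu>"
  unfolding low_def by (auto intro: span_add span_diff span_scale span_sum span_zero)

lemma low_A:
  assumes "1 \<le> a" "a < b" "b \<le> n+1" "wt (\<lambda>m. \<nu> m + eps a m - eps b m) w"
  shows "A b a w \<in> low \<nu>"
  unfolding low_def using assms by (intro span_base) blast

text \<open>The corresponding statement for \<open>gl(n+1)\<close>, transported along the action in which the identity is
the scalar \<open>mean \<nu>\<close>. Adding a root does not change the mean, so this one action serves all weights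
that occur in \<open>low \<nu>\<close>.\<close>

lemma highest_weight_not_low:
  assumes u: "u \<in> low \<nu>" "wt \<nu> u" "\<And>p. p \<in> {1..n} \<Longrightarrow> A p (p + 1) u = 0"
  shows "u = 0"
proof -
  interpret g: gl_module scale Basis "n+1" "\<lambda>i j w. A i j w + (if i = j then mean \<nu> *s w else 0)"
    by (rule shifted_gl_module)
  have conv: "g.weight_vec \<xi> w" if "wt \<xi> w" "mean \<xi> = mean \<nu>" for \<xi> w
    using that unfolding g.weight_vec_def wt_def by (simp add: scale_left_diff_distrib)
  have "low \<nu> \<subseteq> g.lowered \<nu>"
    unfolding low_def g.lowered_def
  proof (rule span_mono, safe)
    fix a b w assume *: "1 \<le> a" "a < b" "b \<le> n+1" "wt (\<lambda>m. \<nu> m + eps a m - eps b m) w"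
    have "g.weight_vec (\<lambda>m. \<nu> m + eps a m - eps b m) w"
      using * by (intro conv) (auto intro: mean_root)
    then show "\<exists>a' b' w'. A b a w = A b' a' w' + (if b' = a' then mean \<nu> *s w' else 0)
      \<and> 1 \<le> a' \<and> a' < b' \<and> b' \<le> n+1 \<and> g.weight_vec (\<lambda>m. \<nu> m + eps a' m - eps b' m) w'"
      using * by (intro exI[of _ a] exI[of _ b] exI[of _ w]) auto
  qed
  then show ?thesis
    using u conv[of \<nu> u] by (intro g.highest_weight_vec_not_lowered[of u \<nu>]) auto
qed

lemma highest_weight_antimono:
  assumes "wt \<nu> v" "v \<noteq> 0" "p \<in> {1..n}" "A p (p + 1) v = 0"
  shows "\<nu> (p + 1) \<le> \<nu> p"
proof -
  interpret g: gl_module scale Basis "n+1" "\<lambda>i j w. A i j w + (if i = j then mean \<nu> *s w else 0)"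
    by (rule shifted_gl_module)
  have "g.weight_vec \<nu> v" using assms(1) unfolding g.weight_vec_def wt_def by (simp add: scale_left_diff_distrib)
  then show ?thesis using g.highest_weight_dominant[of \<nu> v p] assms by simp
qed


section \<open>The operators Q and the raising operators\<close>

abbreviation Q :: "weight \<Rightarrow> nat \<Rightarrow> nat \<Rightarrow> 'v \<Rightarrow> 'v" where "Q \<equiv> Q_act n rho"

text \<open>\<open>Fcoeff\<close> is the scalar in \<open>F\<^bsup>(\<mu>(s))\<^esup>\<close>, but \<open>Pcoeff\<close> the one in \<open>P\<^bsup>(\<mu>(s+1))\<^esup>\<close>. The map \<open>\<phi>\<^sub>s\<^sub>+\<^sub>1\<close> combines
these two, and with this shift both are products of factors \<open>\<mu>\<^sub>m\<^sub>,\<^sub>s\<close>. Accordingly the lemmas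
below treat \<open>\<phi>\<^sub>s\<^sub>+\<^sub>1\<close>.\<close>

definition Fcoeff :: "weight \<Rightarrow> nat \<Rightarrow> nat \<Rightarrow> nat \<Rightarrow> complex" where
  "Fcoeff \<mu> s k l = of_int (\<Prod>m=k+1..l. mu_coeff \<mu> m s)"

definition Pcoeff :: "weight \<Rightarrow> nat \<Rightarrow> nat \<Rightarrow> complex" where
  "Pcoeff \<mu> s k = of_int (\<Prod>m=1..k-1. mu_coeff \<mu> m s)"

lemma Q_top: "s < k \<Longrightarrow> Q \<mu> s k w = w"
  by (simp add: Q_act.simps)

lemma rho_F_mod:
  assumes "1 \<le> k" "k \<le> l" "l \<le> n"
  shows "rho (F_mod n \<mu> s k l) w = Fcoeff \<mu> s k l *s A (l + 1) k w"
proof -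
  have "elF n k l = sl_unit (l + 1) k"
    using assms by (auto simp: elF_def sl_unit_def mat_unit_def of_sl_def)
  then show ?thesis
    using assms by (simp add: F_mod_def rho_smult sl_unit_carrier A_def Fcoeff_def)
qed

lemma Q_linear_aux:
  assumes "1 \<le> k" "s \<le> n"
  shows "Q \<mu> s k (u + w) = Q \<mu> s k u + Q \<mu> s k w \<and> Q \<mu> s k (c *s w) = c *s Q \<mu> s k w"
  using assms(1)
proof (induction "s + 1 - k" arbitrary: k u w c rule: less_induct)
  case less
  show ?case
  proof (cases "k \<le> s")
    case True
    have IH: "Q \<mu> s (l + 1) (u + w) = Q \<mu> s (l + 1) u + Q \<mu> s (l + 1) w"
      "Q \<mu> s (l + 1) (c *s w) = c *s Q \<mu> s (l + 1) w" if "l \<in> {k..s}" for l u w c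
      using less.hyps[of "l + 1" u w c] that True by auto
    have F: "rho (F_mod n \<mu> s k l) w = Fcoeff \<mu> s k l *s A (l + 1) k w" if "l \<in> {k..s}" for l w
      using that less.prems assms by (intro rho_F_mod) auto
    have rec: "Q \<mu> s k w = (\<Sum>l=k..s. Fcoeff \<mu> s k l *s Q \<mu> s (l + 1) (A (l + 1) k w))" for w
      using True by (subst Q_act.simps) (simp add: F IH(2)[simplified])
    show ?thesis unfolding rec
      using less.prems assms True IH
      by (simp add: A_add A_scale scale_right_distrib sum.distrib scale_sum_right mult.commute)
  qed (simp add: Q_top)
qed

lemma Q_add: "1 \<le> k \<Longrightarrow> s \<le> n \<Longrightarrow> Q \<mu> s k (u + w) = Q \<mu> s k u + Q \<mu> s k w"
  and Q_scale: "1 \<le> k \<Longrightarrow> s \<le> n \<Longrightarrow> Q \<mu> s k (c *s w) = c *s Q \<mu> s k w"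
  by (simp_all add: Q_linear_aux)

lemma Q_zero: "1 \<le> k \<Longrightarrow> s \<le> n \<Longrightarrow> Q \<mu> s k 0 = 0"
  using Q_scale[of k s \<mu> 0 0] by simp

lemma Q_diff: "1 \<le> k \<Longrightarrow> s \<le> n \<Longrightarrow> Q \<mu> s k (u - w) = Q \<mu> s k u - Q \<mu> s k w"
  using Q_add[of k s \<mu> "u - w" w] by (simp add: algebra_simps)

lemma Q_rec:
  assumes "1 \<le> k" "k \<le> s" "s \<le> n"
  shows "Q \<mu> s k w = (\<Sum>l=k..s. Fcoeff \<mu> s k l *s Q \<mu> s (l + 1) (A (l + 1) k w))"
proof -
  have "Q \<mu> s k w = (\<Sum>l=k..s. Q \<mu> s (l + 1) (rho (F_mod n \<mu> s k l) w))"
    using assms by (subst Q_act.simps) simp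
  then show ?thesis using assms by (simp add: rho_F_mod Q_scale)
qed

lemma phi_expand:
  assumes "s \<le> n"
  shows "phi n rho (s + 1) \<mu> v = (\<Sum>k=1..s+1. Pcoeff \<mu> s k *s Q \<mu> s k (P k v))"
proof -
  have "rho (P_mod n \<mu> (s + 1) k) v = Pcoeff \<mu> s k *s P k v" for k
    by (simp add: P_mod_def rho_smult elP_carrier Pcoeff_def P_def)
  then show ?thesis using assms by (simp add: phi_def Q_scale Q_top add.commute)
qed

text \<open>\<open>E\<^sub>p\<close> commutes with every \<open>F\<^sub>k\<^sub>,\<^sub>l\<close> that occurs in \<open>Q\<^sub>k\<close>.\<close>

lemma raising_Q_outside:
  assumes p: "p \<in> {1..n}" and k: "1 \<le> k" and s: "s \<le> n" and out: "p < k \<or> s < p"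
  shows "A p (p + 1) (Q \<mu> s k w) = Q \<mu> s k (A p (p + 1) w)"
  using k out
proof (induction "s + 1 - k" arbitrary: k w rule: less_induct)
  case less
  show ?case
  proof (cases "k \<le> s")
    case True
    have "A p (p + 1) (Q \<mu> s (l + 1) (A (l + 1) k w)) = Q \<mu> s (l + 1) (A (l + 1) k (A p (p + 1) w))"
      if l: "l \<in> {k..s}" for l
    proof -
      have "A p (p + 1) (A (l + 1) k w) = A (l + 1) k (A p (p + 1) w)"
        using A_swap[of p "p + 1" "l + 1" k w] p l less.prems s by auto
      then show ?thesis
        using less.hyps[of "l + 1" "A (l + 1) k w"] less.prems l True by auto
    qed
    then show ?thesis
      using True less.prems s p by (simp add: Q_rec A_sum A_scale)
  qed (simp add: Q_top)
qed

text \<open>Commuting \<open>E\<^sub>p\<close> past the first factor \<open>F\<^sub>p\<^sub>,\<^sub>l\<close> leaves \<open>H\<^sub>p\<close> if \<open>l = p\<close> and \<open>- F\<^sub>p\<^sub>+\<^sub>1\<^sub>,\<^sub>l\<close> if \<open>l > p\<close>; the latter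
terms reassemble to \<open>Q\<^sub>p\<^sub>+\<^sub>1\<close> with the one additional factor \<open>\<mu>\<^sub>p\<^sub>+\<^sub>1\<^sub>,\<^sub>s\<close>. For \<open>p = s\<close> there are no such terms and the
factor \<open>\<mu>\<^sub>s\<^sub>+\<^sub>1\<^sub>,\<^sub>s\<close> is an empty sum.\<close>

lemma raising_Q_diagonal:
  assumes p: "1 \<le> p" "p \<le> s" and s: "s \<le> n"
  shows "A p (p + 1) (Q \<mu> s p w) = Q \<mu> s p (A p (p + 1) w)
    + Q \<mu> s (p + 1) (A p p w - A (p + 1) (p + 1) w - of_int (mu_coeff \<mu> (p + 1) s) *s w)"
proof -
  let ?E = "A p (p + 1)" and ?G = "\<lambda>l w. Fcoeff \<mu> s p l *s Q \<mu> s (l + 1) w"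
  have summand: "?E (Q \<mu> s (l + 1) (A (l + 1) p w)) = Q \<mu> s (l + 1) (A (l + 1) p (?E w))
      + ((if l = p then Q \<mu> s (p + 1) (A p p w) else 0) - Q \<mu> s (l + 1) (A (l + 1) (p + 1) w))"
    if l: "l \<in> {p..s}" for l
  proof -
    have "?E (Q \<mu> s (l + 1) (A (l + 1) p w)) = Q \<mu> s (l + 1) (?E (A (l + 1) p w))"
      using p s l by (intro raising_Q_outside) auto
    moreover have "?E (A (l + 1) p w) = A (l + 1) p (?E w) + ((if l = p then A p p w else 0) - A (l + 1) (p + 1) w)"
      using A_swap[of p "p + 1" "l + 1" p w] p l s by simp
    ultimately show ?thesis using s by (auto simp: Q_add Q_diff Q_zero)
  qed
  have "?E (Q \<mu> s p w) = (\<Sum>l=p..s. Fcoeff \<mu> s p l *s ?E (Q \<mu> s (l + 1) (A (l + 1) p w)))"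
    unfolding Q_rec[OF p s] using p s by (simp add: A_sum A_scale)
  also have "\<dots> = (\<Sum>l=p..s. ?G l (A (l + 1) p (?E w))
      + ((if l = p then ?G p (A p p w) else 0) - ?G l (A (l + 1) (p + 1) w)))"
    by (intro sum.cong refl, subst summand) (auto simp: scale_right_distrib scale_right_diff_distrib)
  also have "\<dots> = Q \<mu> s p (?E w) + (\<Sum>l=p..s. if l = p then ?G p (A p p w) else 0)
      - (\<Sum>l=p..s. ?G l (A (l + 1) (p + 1) w))"
    using p s by (simp add: Q_rec sum.distrib sum_subtractf)
  also have "(\<Sum>l=p..s. if l = p then ?G p (A p p w) else 0) = Q \<mu> s (p + 1) (A p p w)"
    using p by (simp add: Fcoeff_def)
  also have "(\<Sum>l=p..s. ?G l (A (l + 1) (p + 1) w))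
      = Q \<mu> s (p + 1) (A (p + 1) (p + 1) w) + (\<Sum>l=p+1..s. ?G l (A (l + 1) (p + 1) w))"
    using p by (subst sum.atLeast_Suc_atMost) (auto simp: Fcoeff_def)
  also have "(\<Sum>l=p+1..s. ?G l (A (l + 1) (p + 1) w)) = of_int (mu_coeff \<mu> (p + 1) s) *s Q \<mu> s (p + 1) w"
  proof (cases "p = s")
    case True
    then show ?thesis by (simp add: mu_coeff_def)
  next
    case False
    have F: "Fcoeff \<mu> s p l = of_int (mu_coeff \<mu> (p + 1) s) * Fcoeff \<mu> s (p + 1) l" if "l \<in> {p+1..s}" for l
      using that prod.atLeast_Suc_atMost[of "p + 1" l "\<lambda>m. mu_coeff \<mu> m s"] by (simp add: Fcoeff_def)
    have "Q \<mu> s (p + 1) w = (\<Sum>l=p+1..s. Fcoeff \<mu> s (p + 1) l *s Q \<mu> s (l + 1) (A (l + 1) (p + 1) w))"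
      using False p s by (intro Q_rec) auto
    then show ?thesis by (simp only: scale_sum_right) (intro sum.cong refl, simp only: F scale_scale)
  qed
  finally show ?thesis using s by (simp add: Q_add Q_diff Q_scale algebra_simps)
qed

lemma mu_coeff_step: "p \<le> s \<Longrightarrow> mu_coeff \<mu> p s = mu_coeff \<mu> (p + 1) s - (\<mu> p + 1)"
  by (simp add: mu_coeff_def sum.atLeast_Suc_atMost)

text \<open>Here \<open>E\<^sub>p\<close> interacts with the factors ending in \<open>p\<close> and those starting at \<open>p\<close>: the term \<open>l = p\<close>
gives \<open>F\<^sub>k\<^sub>,\<^sub>p\<^sub>-\<^sub>1\<close> by commutation, the term \<open>l = p - 1\<close> gives it through \<open>raising_Q_diagonal\<close>. The two
contributions cancel since \<open>\<mu>\<^sub>p\<^sub>,\<^sub>s = \<mu>\<^sub>p\<^sub>+\<^sub>1\<^sub>,\<^sub>s - (\<mu>\<^sub>p + 1)\<close>; this cancellation dictates the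
coefficients of \<open>F\<close>.\<close>

lemma raising_Q_inside:
  assumes k: "1 \<le> k" "k < p" and p: "p \<le> s" and s: "s \<le> n"
    and H: "A p p w - A (p + 1) (p + 1) w = of_int (\<mu> p) *s w"
  shows "A p (p + 1) (Q \<mu> s k w) = Q \<mu> s k (A p (p + 1) w)"
  using k H
proof (induction "s + 1 - k" arbitrary: k w rule: less_induct)
  case less
  let ?E = "A p (p + 1)" and ?w = "A p k w"
  let ?a = "of_int (mu_coeff \<mu> (p + 1) s) :: complex"
  have r: "p \<in> {1..n+1}" "p + 1 \<in> {1..n+1}" "k \<in> {1..n+1}" using less.prems p s by auto
  \<comment> \<open>\<open>D l\<close> is the failure of the \<open>l\<close>-th summand to commute with \<open>E\<^sub>p\<close>.\<close>
  define D where "D l = (if l = p - 1 then (Fcoeff \<mu> s k (p - 1) * (of_int (\<mu> p) + 1 - ?a)) *s Q \<mu> s (p + 1) ?w else 0)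
      + (if l = p then Fcoeff \<mu> s k p *s Q \<mu> s (p + 1) ?w else 0)" for l
  have summand: "Fcoeff \<mu> s k l *s ?E (Q \<mu> s (l + 1) (A (l + 1) k w))
      = Fcoeff \<mu> s k l *s Q \<mu> s (l + 1) (A (l + 1) k (?E w)) + D l" if l: "l \<in> {k..s}" for l
  proof -
    have l1: "l + 1 \<in> {1..n+1}" using l s by auto
    consider "l + 1 < p" | "l = p - 1" | "l = p" | "p < l" by linarith
    then show ?thesis
    proof cases
      case 1
      have "A p p (A (l + 1) k w) - A (p + 1) (p + 1) (A (l + 1) k w)
          = A (l + 1) k (A p p w - A (p + 1) (p + 1) w)"
        using A_swap[OF r(1,1) l1 r(3), of w] A_swap[OF r(2,2) l1 r(3), of w] 1 less.prems(1,2) l1 r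
        by (simp add: A_diff)
      then have "?E (Q \<mu> s (l + 1) (A (l + 1) k w)) = Q \<mu> s (l + 1) (?E (A (l + 1) k w))"
        using less.hyps[of "l + 1" "A (l + 1) k w"] less.prems 1 l l1 r diff_less_mono2[of k "l + 1" "s + 1"]
        by (simp add: A_scale)
      moreover have "?E (A (l + 1) k w) = A (l + 1) k (?E w)"
        using A_swap[OF r(1,2) l1 r(3), of w] 1 less.prems by simp
      moreover have "l \<noteq> p - 1" "l \<noteq> p" using 1 by auto
      ultimately show ?thesis by (simp add: D_def)
    next
      case 2
      have l: "l + 1 = p" using 2 less.prems by simp
      have "A p p ?w - A (p + 1) (p + 1) ?w = A p k (A p p w - A (p + 1) (p + 1) w) + ?w"
        using A_swap[OF r(1,1,1,3), of w] A_swap[OF r(2,2,1,3), of w] less.prems(1,2) r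
        by (simp add: A_diff)
      then have "A p p ?w - A (p + 1) (p + 1) ?w - ?a *s ?w = (of_int (\<mu> p) + 1 - ?a) *s ?w"
        using less.prems r by (simp add: A_scale scale_left_distrib scale_left_diff_distrib)
      moreover have "?E ?w = A p k (?E w)"
        using A_swap[OF r(1,2,1,3), of w] less.prems by simp
      moreover have "l \<noteq> p" using l by simp
      ultimately show ?thesis
        using raising_Q_diagonal[of p s \<mu> ?w] p s r 2
        unfolding l by (simp add: D_def Q_scale scale_right_distrib)
    next
      case 3
      have "?E (Q \<mu> s (p + 1) (A (p + 1) k w)) = Q \<mu> s (p + 1) (?E (A (p + 1) k w))"
        using p s r by (intro raising_Q_outside) auto
      moreover have "?E (A (p + 1) k w) = A (p + 1) k (?E w) + ?w"
        using A_swap[OF r(1,2,2,3), of w] less.prems by simp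
      moreover have "p \<noteq> p - 1" using r by auto
      ultimately show ?thesis using 3 s by (simp add: D_def Q_add scale_right_distrib)
    next
      case 4
      have "?E (Q \<mu> s (l + 1) (A (l + 1) k w)) = Q \<mu> s (l + 1) (?E (A (l + 1) k w))"
        using p s r 4 by (intro raising_Q_outside) auto
      moreover have "?E (A (l + 1) k w) = A (l + 1) k (?E w)"
        using A_swap[OF r(1,2) l1 r(3), of w] 4 less.prems by simp
      moreover have "l \<noteq> p - 1" "l \<noteq> p" using 4 by auto
      ultimately show ?thesis by (simp add: D_def)
    qed
  qed
  have ks: "1 \<le> k" "k \<le> s" using less.prems p by auto
  have "?E (Q \<mu> s k w) = (\<Sum>l=k..s. Fcoeff \<mu> s k l *s ?E (Q \<mu> s (l + 1) (A (l + 1) k w)))"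
    unfolding Q_rec[OF ks s] using r by (simp add: A_sum A_scale)
  also have "\<dots> = Q \<mu> s k (?E w) + (\<Sum>l=k..s. D l)"
    unfolding Q_rec[OF ks s] sum.distrib[symmetric] by (intro sum.cong refl summand)
  also have "(\<Sum>l=k..s. D l) = (Fcoeff \<mu> s k (p - 1) * (of_int (\<mu> p) + 1 - ?a) + Fcoeff \<mu> s k p) *s Q \<mu> s (p + 1) ?w"
    using less.prems p unfolding D_def sum.distrib
    by (subst (1 2) sum.delta) (auto simp: scale_left_distrib)
  also have "Fcoeff \<mu> s k p = Fcoeff \<mu> s k (p - 1) * of_int (mu_coeff \<mu> p s)"
  proof -
    obtain p' where "p = Suc p'" using r by (cases p) auto
    then show ?thesis using less.prems by (simp add: Fcoeff_def)
  qed
  also have "mu_coeff \<mu> p s = mu_coeff \<mu> (p + 1) s - (\<mu> p + 1)" using p by (rule mu_coeff_step)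
  finally show ?case by (simp add: algebra_simps)
qed

text \<open>Only the summands \<open>k = p\<close> and \<open>k = p + 1\<close> survive, the first through \<open>raising_Q_diagonal\<close>, the
second through \<open>E\<^sub>p P\<^sub>p\<^sub>+\<^sub>1 v = P\<^sub>p v\<close>. Both are multiples of \<open>Q\<^sub>p\<^sub>+\<^sub>1 P\<^sub>p v\<close>, and the coefficients of \<open>P\<close> are
chosen so that they cancel.\<close>

lemma raising_phi:
  assumes p: "p \<in> {1..n}" and s: "s \<le> n"
    and H: "A p p v - A (p + 1) (p + 1) v = of_int (\<mu> p) *s v" and E: "A p (p + 1) v = 0"
  shows "A p (p + 1) (phi n rho (s + 1) \<mu> v) = 0"
proof -
  let ?E = "A p (p + 1)" and ?a = "of_int (mu_coeff \<mu> (p + 1) s) :: complex"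
  have r: "p \<in> {1..n+1}" "p + 1 \<in> {1..n+1}" using p by auto
  have EP: "?E (P k v) = (if k = p + 1 then P p v else 0)" if "k \<in> {1..s+1}" for k
    using A_P_swap[OF r, of k v] that s E by (auto simp: P_zero)
  \<comment> \<open>\<open>D k\<close> is what \<open>E\<^sub>p\<close> makes of the \<open>k\<close>-th summand if \<open>p \<le> s\<close>; for \<open>p > s\<close> every summand is killed.\<close>
  define D where "D k = (if k = p then (Pcoeff \<mu> s p * (of_int (\<mu> p) + 1 - ?a)) *s Q \<mu> s (p + 1) (P p v) else 0)
     + (if k = p + 1 then Pcoeff \<mu> s (p + 1) *s Q \<mu> s (p + 1) (P p v) else 0)" for k
  have summand: "Pcoeff \<mu> s k *s ?E (Q \<mu> s k (P k v)) = (if p \<le> s then D k else 0)" if k: "k \<in> {1..s+1}" for k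
  proof -
    consider "s < p" | "p \<le> s" "p + 1 < k" | "p \<le> s" "k = p + 1" | "p \<le> s" "k = p" | "p \<le> s" "k < p" by linarith
    then show ?thesis
    proof cases
      case 1
      then have "?E (Q \<mu> s k (P k v)) = Q \<mu> s k (?E (P k v))"
        using p k s by (intro raising_Q_outside) auto
      then show ?thesis using 1 k s EP[OF k] by (simp add: Q_zero)
    next
      case 2
      then have "?E (Q \<mu> s k (P k v)) = Q \<mu> s k (?E (P k v))"
        using p k s by (intro raising_Q_outside) auto
      then show ?thesis using 2 k s EP[OF k] by (simp add: Q_zero D_def)
    next
      case 3
      then have "?E (Q \<mu> s k (P k v)) = Q \<mu> s k (?E (P k v))"
        using p k s by (intro raising_Q_outside) auto
      then show ?thesis using 3 k s EP[OF k] by (simp add: D_def)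
    next
      case 4
      have "A p p (P p v) - A (p + 1) (p + 1) (P p v) = P p (A p p v - A (p + 1) (p + 1) v) + P p v"
        using A_P_swap[OF r(1,1,1), of v] A_P_swap[OF r(2,2,1), of v]
        by (simp add: P_diff)
      then have "A p p (P p v) - A (p + 1) (p + 1) (P p v) - ?a *s P p v = (of_int (\<mu> p) + 1 - ?a) *s P p v"
        unfolding H by (simp add: P_scale scale_left_distrib scale_left_diff_distrib)
      then have "?E (Q \<mu> s p (P p v)) = Q \<mu> s p (?E (P p v)) + Q \<mu> s (p + 1) ((of_int (\<mu> p) + 1 - ?a) *s P p v)"
        using raising_Q_diagonal[of p s \<mu> "P p v"] p 4 s by simp
      then show ?thesis using 4 k s EP[OF k] by (simp add: D_def Q_zero Q_scale)
    next
      case 5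
      have "A p p (P k v) - A (p + 1) (p + 1) (P k v) = P k (A p p v - A (p + 1) (p + 1) v)"
        using A_P_swap[OF r(1,1), of k v] A_P_swap[OF r(2,2), of k v] 5 k s
        by (simp add: P_diff)
      then have "A p p (P k v) - A (p + 1) (p + 1) (P k v) = of_int (\<mu> p) *s P k v"
        unfolding H by (simp add: P_scale)
      then have "?E (Q \<mu> s k (P k v)) = Q \<mu> s k (?E (P k v))"
        using 5 k s by (intro raising_Q_inside) auto
      then show ?thesis using 5 k s EP[OF k] by (simp add: Q_zero D_def)
    qed
  qed
  have "?E (phi n rho (s + 1) \<mu> v) = (\<Sum>k=1..s+1. Pcoeff \<mu> s k *s ?E (Q \<mu> s k (P k v)))"
    unfolding phi_expand[OF s] A_sum[OF r] A_scale[OF r] ..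
  also have "\<dots> = (\<Sum>k=1..s+1. if p \<le> s then D k else 0)"
    by (intro sum.cong refl summand)
  also have "\<dots> = 0"
  proof (cases "p \<le> s")
    case True
    have P1: "Pcoeff \<mu> s (p + 1) = Pcoeff \<mu> s p * of_int (mu_coeff \<mu> p s)"
    proof -
      obtain p' where "p = Suc p'" using p by (cases p) auto
      then show ?thesis by (simp add: Pcoeff_def)
    qed
    have "(\<Sum>k=1..s+1. D k) = (Pcoeff \<mu> s p * (of_int (\<mu> p) + 1 - ?a) + Pcoeff \<mu> s (p + 1)) *s Q \<mu> s (p + 1) (P p v)"
      unfolding D_def sum.distrib using p True
      by (subst (1 2) sum.delta) (auto simp: scale_left_distrib)
    also have "Pcoeff \<mu> s p * (of_int (\<mu> p) + 1 - ?a) + Pcoeff \<mu> s (p + 1) = 0"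
      unfolding P1 mu_coeff_step[OF True] by (simp add: algebra_simps)
    finally show ?thesis using True by simp
  qed simp
  finally show ?thesis .
qed


section \<open>Compositions of two maps modulo lowered vectors\<close>

lemma wt_Q:
  assumes s: "s \<le> n" and k: "1 \<le> k" "k \<le> s + 1" and w: "wt \<nu> w"
  shows "wt (\<lambda>m. \<nu> m + eps (s + 1) m - eps k m) (Q \<mu> s k w)"
  using k w
proof (induction "s + 1 - k" arbitrary: k \<nu> w rule: less_induct)
  case less
  show ?case
  proof (cases "k \<le> s")
    case True
    have "wt (\<lambda>m. \<nu> m + eps (s + 1) m - eps k m) (Q \<mu> s (l + 1) (A (l + 1) k w))" if l: "l \<in> {k..s}" for l
    proof -
      have "wt (\<lambda>m. \<nu> m + eps (l + 1) m - eps k m) (A (l + 1) k w)"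
        using less.prems l s by (intro wt_A) auto
      moreover have "s + 1 - (l + 1) < s + 1 - k" using l by auto
      ultimately have "wt (\<lambda>m. (\<nu> m + eps (l + 1) m - eps k m) + eps (s + 1) m - eps (l + 1) m)
          (Q \<mu> s (l + 1) (A (l + 1) k w))"
        using l s by (intro less.hyps[of "l + 1" "\<lambda>m. \<nu> m + eps (l + 1) m - eps k m"]) auto
      then show ?thesis by (rule wt_cong) auto
    qed
    then show ?thesis using True less.prems s by (simp only: Q_rec) (intro wt_sum wt_scale, simp)
  next
    case False
    then have "k = s + 1" using less.prems by simp
    then show ?thesis using less.prems by (simp add: Q_top)
  qed
qed

lemma wt_phi:
  assumes s: "s \<le> n" and v: "wt \<nu> v"
  shows "wt (\<lambda>m. \<nu> m + eps (s + 1) m) (phi n rho (s + 1) \<mu> v)"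
  unfolding phi_expand[OF s]
proof (intro wt_sum wt_scale)
  fix k assume k: "k \<in> {1..s+1}"
  then have "wt (\<lambda>m. \<nu> m + eps k m) (P k v)" using v s by (intro wt_P) auto
  then have "wt (\<lambda>m. (\<nu> m + eps k m) + eps (s + 1) m - eps k m) (Q \<mu> s k (P k v))"
    using k s by (intro wt_Q) auto
  then show "wt (\<lambda>m. \<nu> m + eps (s + 1) m) (Q \<mu> s k (P k v))" by simp
qed

lemma Q_low:
  assumes s: "s \<le> n" and k: "1 \<le> k" "k \<le> s" and w: "wt (\<lambda>m. \<nu> m + eps k m - eps (s + 1) m) w"
  shows "Q \<mu> s k w \<in> low \<nu>"
  using k w
proof (induction "s + 1 - k" arbitrary: k w rule: less_induct)
  case less
  have "Q \<mu> s (l + 1) (A (l + 1) k w) \<in> low \<nu>" if l: "l \<in> {k..s}" for l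
  proof (cases "l = s")
    case True
    then show ?thesis using less.prems s by (auto simp: Q_top intro: low_A)
  next
    case False
    have "wt (\<lambda>m. (\<nu> m + eps k m - eps (s + 1) m) + eps (l + 1) m - eps k m) (A (l + 1) k w)"
      using less.prems l s by (intro wt_A) auto
    then have "wt (\<lambda>m. \<nu> m + eps (l + 1) m - eps (s + 1) m) (A (l + 1) k w)"
      by (rule wt_cong) auto
    then show ?thesis using less.hyps[of "l + 1" "A (l + 1) k w"] l s False by auto
  qed
  then show ?case using less.prems s by (simp only: Q_rec) (intro low_sum low_scale, simp)
qed


text \<open>Lowering operators moved to the left past \<open>P\<^sub>j\<close> give vectors in \<open>low\<close>. The first
one encountered, \<open>F\<^sub>a\<^sub>,\<^sub>s\<close>, fails to commute with \<open>P\<^sub>j\<close> only for \<open>a = j\<close>, and then \<open>P\<^sub>j\<close> becomes \<open>P\<^sub>s\<^sub>+\<^sub>1\<close>, which commutes with all remaining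
factors. So the only product not in \<open>low\<close> is the single factor \<open>F\<^sub>j\<^sub>,\<^sub>s\<close> in \<open>Q\<^sub>j\<close>.\<close>

lemma P_Q_mod_low:
  assumes s: "s \<le> n" and j: "j \<in> {1..n+1}" and k: "1 \<le> k" "k \<le> s" and w: "wt \<xi> w"
  shows "P j (Q \<mu> s k w) + (if j = k then Fcoeff \<mu> s k s *s P (s + 1) w else 0)
    \<in> low (\<lambda>m. \<xi> m + eps (s + 1) m - eps k m + eps j m)"
  using k w
proof (induction "s + 1 - k" arbitrary: k \<xi> w rule: less_induct)
  case less
  let ?L = "low (\<lambda>m. \<xi> m + eps (s + 1) m - eps k m + eps j m)"
  have summand: "P j (Q \<mu> s (l + 1) (A (l + 1) k w))
      + (if l = s then (if j = k then P (s + 1) w else 0) else 0) \<in> ?L" if l: "l \<in> {k..s}" for l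
  proof (cases "l = s")
    case True
    have "A (s + 1) k (P j w) \<in> ?L"
      using less.prems s j by (intro low_A) (auto intro: wt_cong[OF wt_P])
    moreover have "A (s + 1) k (P j w) = P j (A (s + 1) k w) + (if j = k then P (s + 1) w else 0)"
      using A_P_swap[of "s + 1" k j w] less.prems s j by auto
    ultimately show ?thesis using True by (simp add: Q_top)
  next
    case False
    let ?w = "A (l + 1) k w"
    have lt: "s + 1 - (l + 1) < s + 1 - k" using l by auto
    have w': "wt (\<lambda>m. \<xi> m + eps (l + 1) m - eps k m) ?w"
      using less.prems l s by (intro wt_A) auto
    have L: "low (\<lambda>m. (\<xi> m + eps (l + 1) m - eps k m) + eps (s + 1) m - eps (l + 1) m + eps j m) = ?L"
      by (intro arg_cong[of _ _ low]) auto
    have IH: "P j (Q \<mu> s (l + 1) ?w) + (if j = l + 1 then Fcoeff \<mu> s (l + 1) s *s P (s + 1) ?w else 0) \<in> ?L"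
      using less.hyps[OF lt _ _ w'] l False unfolding L by auto
    have "(if j = l + 1 then Fcoeff \<mu> s (l + 1) s *s P (s + 1) ?w else 0) \<in> ?L"
    proof (cases "j = l + 1")
      case True
      have "P (s + 1) ?w = A (l + 1) k (P (s + 1) w)"
        using A_P_swap[of "l + 1" k "s + 1" w] less.prems l s by auto
      moreover have "A (l + 1) k (P (s + 1) w) \<in> ?L"
        using less.prems s l True by (intro low_A) (auto intro: wt_cong[OF wt_P])
      ultimately show ?thesis using True by (simp add: low_scale)
    qed (simp add: low_zero)
    from low_diff[OF IH this] show ?thesis using False by simp
  qed
  have "P j (Q \<mu> s k w) = (\<Sum>l=k..s. Fcoeff \<mu> s k l *s P j (Q \<mu> s (l + 1) (A (l + 1) k w)))"
    unfolding Q_rec[OF less.prems(1,2) s] by (simp add: P_sum P_scale)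
  moreover have "(if j = k then Fcoeff \<mu> s k s *s P (s + 1) w else 0)
     = (\<Sum>l=k..s. Fcoeff \<mu> s k l *s (if l = s then (if j = k then P (s + 1) w else 0) else 0))"
    using less.prems by (simp add: if_distrib[of "\<lambda>x. _ *s x"] sum.delta cong: if_cong)
  ultimately have "P j (Q \<mu> s k w) + (if j = k then Fcoeff \<mu> s k s *s P (s + 1) w else 0)
    = (\<Sum>l=k..s. Fcoeff \<mu> s k l *s (P j (Q \<mu> s (l + 1) (A (l + 1) k w))
      + (if l = s then (if j = k then P (s + 1) w else 0) else 0)))"
    by (simp only: scale_right_distrib sum.distrib)
  then show ?case by (simp only:) (intro low_sum low_scale summand)
qed

lemma phi_mod_low:
  assumes s: "s \<le> n" and v: "wt \<nu> v"
  shows "phi n rho (s + 1) \<mu> v - Pcoeff \<mu> s (s + 1) *s P (s + 1) v \<in> low (\<lambda>m. \<nu> m + eps (s + 1) m)"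
proof -
  have "phi n rho (s + 1) \<mu> v - Pcoeff \<mu> s (s + 1) *s P (s + 1) v = (\<Sum>k=1..s. Pcoeff \<mu> s k *s Q \<mu> s k (P k v))"
    unfolding phi_expand[OF s] by (simp add: Q_top)
  also have "\<dots> \<in> low (\<lambda>m. \<nu> m + eps (s + 1) m)"
  proof (intro low_sum low_scale Q_low s)
    fix k assume k: "k \<in> {1..s}"
    then have "wt (\<lambda>m. \<nu> m + eps k m) (P k v)" using v s by (intro wt_P) auto
    then show "wt (\<lambda>m. \<nu> m + eps (s + 1) m + eps k m - eps (s + 1) m) (P k v)"
      by (rule wt_cong) auto
  qed auto
  finally show ?thesis .
qed

lemma P_phi_mod_low:
  assumes s: "s \<le> n" and j: "j \<in> {1..n+1}" and v: "wt \<nu> v"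
  shows "P j (phi n rho (s + 1) \<mu> v)
      - (Pcoeff \<mu> s (s + 1) - (if j \<le> s then Pcoeff \<mu> s j * Fcoeff \<mu> s j s else 0)) *s P j (P (s + 1) v)
    \<in> low (\<lambda>m. \<nu> m + eps (s + 1) m + eps j m)"
proof -
  let ?L = "low (\<lambda>m. \<nu> m + eps (s + 1) m + eps j m)"
  let ?c = "\<lambda>k. if j = k then Fcoeff \<mu> s k s *s P (s + 1) (P k v) else 0"
  have L: "P j (Q \<mu> s k (P k v)) + ?c k \<in> ?L" if k: "k \<in> {1..s}" for k
  proof -
    have "wt (\<lambda>m. \<nu> m + eps k m) (P k v)" using v s k by (intro wt_P) auto
    then have "P j (Q \<mu> s k (P k v)) + ?c k
        \<in> low (\<lambda>m. (\<nu> m + eps k m) + eps (s + 1) m - eps k m + eps j m)"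
      using k s j by (intro P_Q_mod_low) auto
    then show ?thesis by simp
  qed
  have "(\<Sum>k=1..s. Pcoeff \<mu> s k *s (P j (Q \<mu> s k (P k v)) + ?c k)) \<in> ?L"
    by (intro low_sum low_scale L)
  also have "(\<Sum>k=1..s. Pcoeff \<mu> s k *s (P j (Q \<mu> s k (P k v)) + ?c k))
     = (\<Sum>k=1..s. Pcoeff \<mu> s k *s P j (Q \<mu> s k (P k v))) + (\<Sum>k=1..s. Pcoeff \<mu> s k *s ?c k)"
    by (simp only: scale_right_distrib sum.distrib)
  also have "(\<Sum>k=1..s. Pcoeff \<mu> s k *s P j (Q \<mu> s k (P k v)))
     = P j (phi n rho (s + 1) \<mu> v) - Pcoeff \<mu> s (s + 1) *s P j (P (s + 1) v)"
    unfolding phi_expand[OF s] by (simp add: Q_top P_add P_sum P_scale)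
  also have "(\<Sum>k=1..s. Pcoeff \<mu> s k *s ?c k) = (\<Sum>k=1..s. if k = j then (Pcoeff \<mu> s j * Fcoeff \<mu> s j s) *s P j (P (s + 1) v) else 0)"
    by (intro sum.cong) (auto simp: P_swap[of "Suc s" j])
  also have "\<dots> = (if j \<le> s then Pcoeff \<mu> s j * Fcoeff \<mu> s j s else 0) *s P j (P (s + 1) v)"
    using j by (subst sum.delta) auto
  finally show ?thesis by (simp add: scale_left_diff_distrib algebra_simps split: if_splits)
qed

text \<open>The outer map contributes only its last summand, a multiple of \<open>P\<^sub>r\<^sub>+\<^sub>1\<close>; applied to the inner map,
\<open>P\<^sub>r\<^sub>+\<^sub>1\<close> interacts with at most one summand besides the last. The conditional term is that
interaction, which occurs for the order with \<open>r < s\<close> only.\<close>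

lemma phi_phi_mod_low:
  assumes s: "s \<le> n" and r: "r \<le> n" and v: "wt \<nu> v"
  shows "phi n rho (r + 1) \<mu>' (phi n rho (s + 1) \<mu> v)
      - (Pcoeff \<mu>' r (r + 1) * (Pcoeff \<mu> s (s + 1) - (if r + 1 \<le> s then Pcoeff \<mu> s (r + 1) * Fcoeff \<mu> s (r + 1) s else 0)))
        *s P (r + 1) (P (s + 1) v)
    \<in> low (\<lambda>m. \<nu> m + eps (s + 1) m + eps (r + 1) m)" (is "_ - (?c * ?d) *s _ \<in> ?L")
proof -
  let ?u = "phi n rho (s + 1) \<mu> v"
  have 1: "phi n rho (r + 1) \<mu>' ?u - ?c *s P (r + 1) ?u \<in> ?L"
    by (intro phi_mod_low r wt_phi s v)
  have 2: "P (r + 1) ?u - ?d *s P (r + 1) (P (s + 1) v) \<in> ?L"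
    using r by (intro P_phi_mod_low s v) auto
  have "(phi n rho (r + 1) \<mu>' ?u - ?c *s P (r + 1) ?u) + ?c *s (P (r + 1) ?u - ?d *s P (r + 1) (P (s + 1) v)) \<in> ?L"
    by (intro low_add low_scale 1 2)
  then show ?thesis by (simp only: scale_right_diff_distrib scale_scale) simp
qed


section \<open>Commutation of the maps on highest weight vectors\<close>

text \<open>With \<open>Pcoeff_shift_low\<close> this identifies the scalars in \<open>phi_phi_mod_low\<close> for the two orders of
\<open>\<phi>\<^sub>r\<^sub>+\<^sub>1\<close> and \<open>\<phi>\<^sub>s\<^sub>+\<^sub>1\<close>. For \<open>r < s\<close> the product in question does not see the weight change by \<open>\<phi>\<^sub>s\<^sub>+\<^sub>1\<close>.\<close>

lemma Pcoeff_shift_high: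
  assumes "r < s"
  shows "Pcoeff (shift_weight n (s + 1) \<mu>) r (r + 1) = Pcoeff \<mu> r (r + 1)"
proof -
  have "mu_coeff (shift_weight n (s + 1) \<mu>) m r = mu_coeff \<mu> m r" for m
    using assms unfolding mu_coeff_def
    by (intro arg_cong[of _ _ uminus] sum.cong) (auto simp: shift_weight_def fund_weight_def)
  then show ?thesis by (simp add: Pcoeff_def)
qed

text \<open>Adding \<open>\<omega>\<^sub>r\<^sub>+\<^sub>1 - \<omega>\<^sub>r\<close> to the weight changes only \<open>\<mu>\<^sub>r\<^sub>+\<^sub>1\<^sub>,\<^sub>s\<close> among the factors, lowering it by one. Expanding
that factor gives the difference on the right, which is exactly the correction coming from
\<open>F\<^sub>r\<^sub>+\<^sub>1\<^sub>,\<^sub>s\<close> in the other order.\<close>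

lemma Pcoeff_shift_low:
  assumes rs: "r < s" "s \<le> n"
  shows "Pcoeff (shift_weight n (r + 1) \<mu>) s (s + 1)
    = Pcoeff \<mu> s (s + 1) - Pcoeff \<mu> s (r + 1) * Fcoeff \<mu> s (r + 1) s"
proof -
  let ?a = "\<lambda>m. mu_coeff \<mu> m s"
  have a: "mu_coeff (shift_weight n (r + 1) \<mu>) m s = (if m = r + 1 then ?a m - 1 else ?a m)" if m: "m \<ge> 1" for m
  proof -
    have "(\<Sum>i=m..s. shift_weight n (r + 1) \<mu> i + 1)
        = (\<Sum>i=m..s. (\<mu> i + 1) + (if i = r + 1 then 1 else 0) - (if i = r then 1 else 0))"
      using m rs by (intro sum.cong) (auto simp: shift_weight_def fund_weight_def)
    also have "\<dots> = (\<Sum>i=m..s. \<mu> i + 1) + (if r + 1 \<in> {m..s} then 1 else 0) - (if r \<in> {m..s} then 1 else 0)"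
      unfolding sum.distrib sum_subtractf by (subst (1 2) sum.delta) auto
    finally show ?thesis using rs by (auto simp: mu_coeff_def)
  qed
  have split: "(\<Prod>m=1..s. g m) = (\<Prod>m=1..r. g m) * g (r + 1) * (\<Prod>m=r+2..s. g m)" for g :: "nat \<Rightarrow> int"
  proof -
    have "{1..s} = {1..r} \<union> {r+1} \<union> {r+2..s}" using rs by auto
    moreover have "(\<Prod>m\<in>{1..r} \<union> {r+1} \<union> {r+2..s}. g m) = (\<Prod>m=1..r. g m) * g (r + 1) * (\<Prod>m=r+2..s. g m)"
      by (subst prod.union_disjoint; (subst prod.union_disjoint)?) auto
    ultimately show ?thesis by simp
  qed
  have "(\<Prod>m=1..s. mu_coeff (shift_weight n (r + 1) \<mu>) m s)
     = (\<Prod>m=1..r. ?a m) * (?a (r + 1) - 1) * (\<Prod>m=r+2..s. ?a m)"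
    unfolding split by (intro arg_cong2[of _ _ _ _ "(*)"] prod.cong refl) (auto simp: a[simplified])
  also have "\<dots> = (\<Prod>m=1..s. ?a m) - (\<Prod>m=1..r. ?a m) * (\<Prod>m=r+2..s. ?a m)"
    unfolding split by (simp add: algebra_simps)
  finally show ?thesis by (simp add: Pcoeff_def Fcoeff_def of_int_diff[symmetric] of_int_mult[symmetric]
        del: of_int_prod of_int_diff of_int_mult)
qed

text \<open>Highest weight vectors in the coordinates \<open>\<nu>\<close>. The zero vector is included, so that the
maps preserve this predicate without a case distinction.\<close>

definition hw :: "weight \<Rightarrow> (nat \<Rightarrow> int) \<Rightarrow> 'v \<Rightarrow> bool" where
  "hw \<mu> \<nu> v \<longleftrightarrow> wt \<nu> v \<and> (\<forall>i\<in>{1..n}. \<nu> i - \<nu> (i + 1) = \<mu> i) \<and> (\<forall>p\<in>{1..n}. A p (p + 1) v = 0)"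

lemma hw_phi:
  assumes v: "hw \<mu> \<nu> v" and i: "i \<in> {1..n+1}"
  shows "hw (shift_weight n i \<mu>) (\<lambda>m. \<nu> m + eps i m) (phi n rho i \<mu> v)"
proof -
  define s where "s = i - 1"
  have s: "i = s + 1" "s \<le> n" using i by (auto simp: s_def)
  have "A p (p + 1) (phi n rho i \<mu> v) = 0" if p: "p \<in> {1..n}" for p
    unfolding s(1) using v p s(2) wt_coroot[of \<nu> v p] by (intro raising_phi) (auto simp: hw_def)
  moreover have "wt (\<lambda>m. \<nu> m + eps i m) (phi n rho i \<mu> v)"
    unfolding s(1) using v s(2) by (intro wt_phi) (auto simp: hw_def)
  ultimately show ?thesis
    using v i by (auto simp: hw_def shift_weight_def fund_weight_def eps_def)
qed

text \<open>Both sides are highest weight vectors of the same weight and agree modulo \<open>low\<close>, so their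
difference is a highest weight vector in \<open>low\<close>.\<close>

lemma phi_phi_commute_less:
  assumes v: "hw \<mu> \<nu> v" and rs: "r < s" "s \<le> n"
  shows "phi n rho (r + 1) (shift_weight n (s + 1) \<mu>) (phi n rho (s + 1) \<mu> v)
    = phi n rho (s + 1) (shift_weight n (r + 1) \<mu>) (phi n rho (r + 1) \<mu> v)" (is "?x = ?y")
proof -
  let ?\<nu> = "\<lambda>m. \<nu> m + eps (s + 1) m + eps (r + 1) m"
  let ?c = "Pcoeff \<mu> r (r + 1) * (Pcoeff \<mu> s (s + 1) - Pcoeff \<mu> s (r + 1) * Fcoeff \<mu> s (r + 1) s)"
  let ?PP = "P (r + 1) (P (s + 1) v)"
  have w: "wt \<nu> v" using v by (simp add: hw_def)
  have "?x - ?c *s ?PP \<in> low ?\<nu>"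
    using phi_phi_mod_low[of s r \<nu> v "shift_weight n (s + 1) \<mu>" \<mu>, unfolded Pcoeff_shift_high[OF rs(1)]] w rs by simp
  moreover have "?y - ?c *s ?PP \<in> low (\<lambda>m. \<nu> m + eps (r + 1) m + eps (s + 1) m)"
    using phi_phi_mod_low[of r s \<nu> v "shift_weight n (r + 1) \<mu>" \<mu>, unfolded Pcoeff_shift_low[OF rs]] w rs
    by (simp add: P_swap[of "Suc s" "Suc r"] mult.commute)
  moreover have sw: "(\<lambda>m. \<nu> m + eps (r + 1) m + eps (s + 1) m) = ?\<nu>" by auto
  ultimately have "(?x - ?c *s ?PP) - (?y - ?c *s ?PP) \<in> low ?\<nu>" by (simp only: low_diff)
  then have low: "?x - ?y \<in> low ?\<nu>" by simp
  have hx: "hw (shift_weight n (r + 1) (shift_weight n (s + 1) \<mu>)) ?\<nu> ?x"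
    using rs by (intro hw_phi v) auto
  have hy: "hw (shift_weight n (s + 1) (shift_weight n (r + 1) \<mu>)) (\<lambda>m. \<nu> m + eps (r + 1) m + eps (s + 1) m) ?y"
    using rs by (intro hw_phi v) auto
  have "?x - ?y = 0"
  proof (rule highest_weight_not_low[OF low])
    show "wt ?\<nu> (?x - ?y)"
      using hx hy[unfolded sw] by (intro wt_diff) (simp_all only: hw_def)
    show "A p (p + 1) (?x - ?y) = 0" if "p \<in> {1..n}" for p
      using hx hy that by (simp add: hw_def A_diff)
  qed
  then show ?thesis by simp
qed

text \<open>The coordinates are normalised by \<open>\<nu>\<^sub>n\<^sub>+\<^sub>1 = 0\<close>. The eigenvalues of the differences \<open>A\<^sub>i\<^sub>,\<^sub>i - A\<^sub>n\<^sub>+\<^sub>1\<^sub>,\<^sub>n\<^sub>+\<^sub>1\<close>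
determine those of the \<open>A\<^sub>i\<^sub>,\<^sub>i\<close> because the latter sum to zero.\<close>

lemma highest_weight_vector_imp_hw:
  assumes v: "highest_weight_vector n scale rho \<mu> v"
  shows "\<exists>\<nu>. hw \<mu> \<nu> v"
proof -
  define \<nu> where "\<nu> i = (\<Sum>j=i..n. \<mu> j)" for i
  have H: "A i i v - A (i + 1) (i + 1) v = of_int (\<mu> i) *s v" if "i \<in> {1..n}" for i
    using v that rho_elH[OF that, of v] by (auto simp: highest_weight_vector_def)
  have \<nu>: "\<nu> i = \<mu> i + \<nu> (i + 1)" if "i \<le> n" for i
    using that by (simp add: \<nu>_def sum.atLeast_Suc_atMost)
  have tel: "A i i v - A (n+1) (n+1) v = of_int (\<nu> i) *s v" if i: "1 \<le> i" "i \<le> n+1" for i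
    using i(2)
  proof (induction rule: inc_induct)
    case base
    show ?case by (simp add: \<nu>_def)
  next
    case (step k)
    then have k: "k \<in> {1..n}" using i by simp
    have "A k k v - A (n+1) (n+1) v = (A k k v - A (k + 1) (k + 1) v) + (A (k + 1) (k + 1) v - A (n+1) (n+1) v)"
      by simp
    also have "\<dots> = of_int (\<nu> k) *s v"
      using step.IH k unfolding H[OF k] by (simp add: \<nu>[of k] scale_left_distrib)
    finally show ?case .
  qed
  have "(\<Sum>i=1..n+1. A i i v - A (n+1) (n+1) v) = of_int (sum \<nu> {1..n+1}) *s v"
    using tel by (simp only: of_int_sum scale_sum_left) (intro sum.cong refl, simp)
  then have S: "of_int (sum \<nu> {1..n+1}) *s v = - (of_nat (n+1) *s A (n+1) (n+1) v)"
    unfolding sum_subtractf A_trace by (simp add: sum_constant_scale del: sum.cl_ivl_Suc)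
  have N: "(1 / of_nat (n+1)) * of_nat (n+1) = (1 :: complex)"
    by (simp del: of_nat_add of_nat_Suc)
  have "mean \<nu> *s v = (1 / of_nat (n+1)) *s (of_int (sum \<nu> {1..n+1}) *s v)"
    by (simp only: mean_def scale_scale times_divide_eq_left mult_1)
  also have "\<dots> = - A (n+1) (n+1) v"
    unfolding S scale_minus_right scale_scale N by simp
  finally have "A (n+1) (n+1) v = - (mean \<nu> *s v)" by simp
  then have "A i i v = (of_int (\<nu> i) - mean \<nu>) *s v" if "i \<in> {1..n+1}" for i
    using tel[of i] that by (simp add: scale_left_diff_distrib algebra_simps)
  moreover have "A p (p + 1) v = 0" if "p \<in> {1..n}" for p
  proof -
    have "rho (elE n p p) v = 0" using v that by (auto simp: highest_weight_vector_def)
    then show ?thesis by (simp add: rho_elE)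
  qed
  ultimately have "hw \<mu> \<nu> v" using \<nu> by (simp add: hw_def wt_def)
  then show ?thesis by blast
qed

lemma hw_dominant:
  assumes "hw \<mu> \<nu> v" "v \<noteq> 0" "i \<in> {1..n}"
  shows "0 \<le> \<mu> i"
proof -
  have "\<nu> (i + 1) \<le> \<nu> i" using assms by (intro highest_weight_antimono) (auto simp: hw_def)
  moreover have "\<nu> i - \<nu> (i + 1) = \<mu> i" using assms by (simp only: hw_def)
  ultimately show ?thesis by simp
qed


section \<open>Iterating the maps\<close>

definition hw_pair :: "weight \<times> 'v \<Rightarrow> bool" where
  "hw_pair x \<longleftrightarrow> (\<exists>\<nu>. hw (fst x) \<nu> (snd x))"

lemma phi_step_eq: "phi_step n rho i x = (shift_weight n i (fst x), phi n rho i (fst x) (snd x))"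
  by (simp add: phi_step_def shift_weight_def split: prod.split)

lemma hw_pair_step: "hw_pair x \<Longrightarrow> i \<in> {1..n+1} \<Longrightarrow> hw_pair (phi_step n rho i x)"
  unfolding hw_pair_def phi_step_eq fst_conv snd_conv using hw_phi by blast

lemma hw_pair_steps: "hw_pair x \<Longrightarrow> i \<in> {1..n+1} \<Longrightarrow> hw_pair ((phi_step n rho i ^^ m) x)"
  by (induction m) (simp_all add: hw_pair_step)

lemma hw_pair_iter: "hw_pair (\<mu>, v) \<Longrightarrow> m \<le> n + 1 \<Longrightarrow> hw_pair (phi_iter n rho \<mu> v t m)"
  by (induction m) (simp_all add: hw_pair_steps)

text \<open>The recorded weights commute because \<open>\<phi>\<^sub>i\<close> and \<open>\<phi>\<^sub>k\<close> add fixed amounts to them.\<close>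

lemma phi_step_commute:
  assumes x: "hw_pair x" and ik: "i \<in> {1..n+1}" "k \<in> {1..n+1}"
  shows "phi_step n rho i (phi_step n rho k x) = phi_step n rho k (phi_step n rho i x)"
proof -
  obtain \<nu> where hw: "hw (fst x) \<nu> (snd x)" using x by (auto simp: hw_pair_def)
  have "shift_weight n i (shift_weight n k (fst x)) = shift_weight n k (shift_weight n i (fst x))"
    by (auto simp: shift_weight_def)
  moreover have "phi n rho i (shift_weight n k (fst x)) (phi n rho k (fst x) (snd x))
      = phi n rho k (shift_weight n i (fst x)) (phi n rho i (fst x) (snd x))"
  proof -
    consider "i < k" | "i = k" | "k < i" by linarith
    then show ?thesis
    proof cases
      case 1
      then show ?thesis using phi_phi_commute_less[OF hw, of "i - 1" "k - 1"] ik by simp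
    next
      case 3
      then show ?thesis using phi_phi_commute_less[OF hw, of "k - 1" "i - 1"] ik by simp
    qed simp
  qed
  ultimately show ?thesis by (simp add: phi_step_eq)
qed

lemma phi_steps_commute:
  assumes x: "hw_pair x" and ik: "i \<in> {1..n+1}" "k \<in> {1..n+1}"
  shows "(phi_step n rho i ^^ a) ((phi_step n rho k ^^ b) x) = (phi_step n rho k ^^ b) ((phi_step n rho i ^^ a) x)"
proof -
  have one: "phi_step n rho i ((phi_step n rho k ^^ b) x) = (phi_step n rho k ^^ b) (phi_step n rho i x)"
    if "hw_pair x" for x
  proof (induction b)
    case (Suc b)
    have "phi_step n rho i ((phi_step n rho k ^^ Suc b) x)
        = phi_step n rho k (phi_step n rho i ((phi_step n rho k ^^ b) x))"
      using phi_step_commute[OF hw_pair_steps[OF that ik(2)] ik] by simp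
    then show ?case by (simp add: Suc)
  qed simp
  show ?thesis
  proof (induction a)
    case (Suc a)
    then show ?case using one[OF hw_pair_steps[OF x ik(1)]] by simp
  qed simp
qed

lemma phi_steps_iter:
  assumes x: "hw_pair (\<mu>, v)" and k: "k \<in> {1..n+1}" and m: "m \<le> n + 1"
  shows "(phi_step n rho k ^^ a) (phi_iter n rho \<mu> v t m)
    = (case (phi_step n rho k ^^ a) (\<mu>, v) of (\<mu>', v') \<Rightarrow> phi_iter n rho \<mu>' v' t m)"
  using m
proof (induction m)
  case (Suc m)
  then have "(phi_step n rho k ^^ a) (phi_iter n rho \<mu> v t (Suc m))
     = (phi_step n rho (Suc m) ^^ t (Suc m)) ((phi_step n rho k ^^ a) (phi_iter n rho \<mu> v t m))"
    using phi_steps_commute[OF hw_pair_iter[OF x, of m t] k, of "Suc m" a "t (Suc m)"] by simp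
  then show ?case using Suc by (simp split: prod.split)
qed simp

text \<open>The vector of the larger tuple \<open>s\<close> arises from that of \<open>t\<close> by applying the excess \<open>s - t\<close>: the
surplus powers are moved past the maps of higher index.\<close>

lemma phi_iter_split:
  assumes x: "hw_pair (\<mu>, v)" and m: "m \<le> n + 1" and le: "\<And>l. l \<in> {1..m} \<Longrightarrow> t l \<le> s l"
  shows "phi_iter n rho \<mu> v s m
    = (case phi_iter n rho \<mu> v t m of (\<mu>', v') \<Rightarrow> phi_iter n rho \<mu>' v' (\<lambda>l. s l - t l) m)"
  using m le
proof (induction m)
  case (Suc m)
  let ?st = "phi_step n rho (Suc m)" and ?d = "\<lambda>l. s l - t l"
  obtain \<mu>' v' where y: "phi_iter n rho \<mu> v t m = (\<mu>', v')" by fastforce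
  have hy: "hw_pair (\<mu>', v')" using hw_pair_iter[OF x, of m t] Suc.prems y by simp
  have "phi_iter n rho \<mu> v s (Suc m) = (?st ^^ (?d (Suc m) + t (Suc m))) (phi_iter n rho \<mu>' v' ?d m)"
    using Suc y by simp
  also have "\<dots> = (?st ^^ ?d (Suc m)) ((?st ^^ t (Suc m)) (phi_iter n rho \<mu>' v' ?d m))"
    by (simp add: funpow_add)
  also have "(?st ^^ t (Suc m)) (phi_iter n rho \<mu>' v' ?d m)
      = (case (?st ^^ t (Suc m)) (\<mu>', v') of (\<mu>'', v'') \<Rightarrow> phi_iter n rho \<mu>'' v'' ?d m)"
    using Suc.prems by (intro phi_steps_iter hy) auto
  finally show ?case using y by (simp split: prod.split)
qed simp

lemma phi_step_zero:
  assumes "snd x = 0" "i \<in> {1..n+1}" shows "snd (phi_step n rho i x) = 0"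
proof -
  obtain s where s: "i = s + 1" "s \<le> n" using assms by (cases i) auto
  show ?thesis
    unfolding s(1) phi_step_eq snd_conv phi_expand[OF s(2)] assms(1) using s(2)
    by (intro sum.neutral) (auto simp: P_zero Q_zero)
qed

lemma phi_steps_zero: "snd x = 0 \<Longrightarrow> i \<in> {1..n+1} \<Longrightarrow> snd ((phi_step n rho i ^^ m) x) = 0"
  by (induction m) (simp_all add: phi_step_zero)

lemma phi_iter_zero: "m \<le> n + 1 \<Longrightarrow> snd (phi_iter n rho \<mu> 0 t m) = 0"
  by (induction m) (simp_all add: phi_steps_zero)

lemma phi_steps_weight:
  assumes "k \<in> {2..n+1}"
  shows "fst ((phi_step n rho k ^^ m) x) (k - 1) = fst x (k - 1) - int m"
  using assms by (induction m) (auto simp: phi_step_eq shift_weight_def fund_weight_def)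

lemma phi_1_steps_weight:
  assumes "n \<ge> 1"
  shows "fst ((phi_step n rho 1 ^^ m) x) 1 = fst x 1 + int m"
  using assms by (induction m) (auto simp: phi_step_eq shift_weight_def fund_weight_def)

text \<open>Moved to the front, \<open>\<phi>\<^sub>k\<^sup>m\<close> acts on \<open>v\<close> itself, where the resulting weight has a negative
coefficient at \<open>\<omega>\<^sub>k\<^sub>-\<^sub>1\<close>.\<close>

lemma phi_steps_vanish:
  assumes x: "hw_pair (\<mu>, v)" and k: "k \<in> {2..n+1}" and m: "\<mu> (k - 1) < int m"
  shows "snd ((phi_step n rho k ^^ m) (phi_iter n rho \<mu> v t (k - 1))) = 0"
proof -
  obtain \<mu>' v' where y: "(phi_step n rho k ^^ m) (\<mu>, v) = (\<mu>', v')" by fastforce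
  have "hw_pair (\<mu>', v')" using hw_pair_steps[OF x, of k m] k y by auto
  then obtain \<nu> where "hw \<mu>' \<nu> v'" by (auto simp: hw_pair_def)
  moreover have "\<mu>' (k - 1) < 0" using phi_steps_weight[OF k, of m "(\<mu>, v)"] y m by simp
  ultimately have "v' = 0" using hw_dominant[of \<mu>' \<nu> v' "k - 1"] k by force
  moreover have "k - 1 \<le> n + 1" "k \<in> {1..n+1}" using k by auto
  ultimately show ?thesis
    using phi_steps_iter[OF x, of k "k - 1" m t] y by (simp add: phi_iter_zero)
qed

text \<open>The vectors \<open>\<phi>\<^sub>1\<^sup>m v\<close> have \<open>H\<^sub>1\<close>-eigenvalues \<open>\<mu>\<^sub>1 + m\<close>, so they form a ladder that must break off.\<close>

lemma phi_1_steps_vanish: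
  assumes n: "n \<ge> 1" and x: "hw_pair (\<mu>, v)"
  shows "\<exists>m. snd ((phi_step n rho 1 ^^ m) (\<mu>, v)) = 0"
proof (rule no_infinite_eigenvalue_ladder)
  show "Vector_Spaces.linear scale scale (\<lambda>w. A 1 1 w - A 2 2 w)"
    using n by unfold_locales (simp_all add: A_add A_scale scale_right_diff_distrib)
  show "inj (\<lambda>m. of_int (\<mu> 1 + int m) :: complex)"
    by (auto intro!: injI simp: of_int_eq_iff simp del: of_int_add)
  fix m
  let ?y = "(phi_step n rho 1 ^^ m) (\<mu>, v)"
  have "hw_pair ?y" by (intro hw_pair_steps x) simp
  then obtain \<nu> where \<nu>: "hw (fst ?y) \<nu> (snd ?y)" by (auto simp: hw_pair_def)
  then have "\<nu> 1 - \<nu> 2 = \<mu> 1 + int m"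
    using n phi_1_steps_weight[OF n, of m "(\<mu>, v)"] by (auto simp: hw_def numeral_2_eq_2)
  then show "A 1 1 (snd ?y) - A 2 2 (snd ?y) = of_int (\<mu> 1 + int m) *s snd ?y"
    using wt_coroot[of \<nu> "snd ?y" 1] \<nu> n by (simp add: hw_def numeral_2_eq_2)
qed

end


section \<open>Bounds and monotonicity\<close>

lemma J_num_positive: "1 \<le> J_num n rho \<mu> v k t"
  unfolding J_num_def by (intro Inf_greatest) (auto simp: one_enat_def)

lemma J_num_le:
  "0 < j \<Longrightarrow> snd ((phi_step n rho k ^^ j) (phi_iter n rho \<mu> v t (k-1))) = 0
    \<Longrightarrow> J_num n rho \<mu> v k t \<le> enat j"
  unfolding J_num_def by (intro Inf_lower) auto

theorem theorem3p25:
  fixes n :: nat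
    and scale :: "complex \<Rightarrow> 'v::ab_group_add \<Rightarrow> 'v"
    and Basis :: "'v set"
    and rho :: "aff \<Rightarrow> 'v \<Rightarrow> 'v"
    and \<mu> :: weight
    and v :: 'v
  assumes "n \<ge> 1"
    and "aff_module scale Basis n rho"
    and "cyclic_generator n scale rho v"
    and "highest_weight_vector n scale rho \<mu> v"
  shows "(\<forall>t. J_num n rho \<mu> v 1 t \<ge> 1)
    \<and> (\<exists>N::nat. \<forall>J\<in>J_set n rho \<mu> v. J \<le> enat N)
    \<and> (\<forall>k\<in>{2..n+1}. \<forall>s t.
          admissible n rho \<mu> v k s \<and> admissible n rho \<mu> v k t \<and> (\<forall>l\<in>{1..k-1}. t l \<le> s l)
          \<longrightarrow> J_num n rho \<mu> v k s \<le> J_num n rho \<mu> v k t)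
    \<and> (\<forall>k\<in>{2..n+1}. \<forall>t. admissible n rho \<mu> v k t
          \<longrightarrow> 1 \<le> J_num n rho \<mu> v k t
            \<and> (\<exists>J::nat. J_num n rho \<mu> v k t = enat J \<and> int J \<le> \<mu> (k-1) + 1))"
proof -
  interpret aff_module scale Basis n rho by fact
  obtain \<nu> where hw: "hw \<mu> \<nu> v" using highest_weight_vector_imp_hw assms(4) by blast
  then have x: "hw_pair (\<mu>, v)" by (auto simp: hw_pair_def)
  have nz: "v \<noteq> 0" using assms(4) by (simp add: highest_weight_vector_def)
  have dominant: "0 \<le> \<mu> i" if "i \<in> {1..n}" for i using hw_dominant[OF hw nz that] .
  have dominant': "0 \<le> \<mu> (k - 1)" if "k \<in> {2..n+1}" for k
    using that by (intro dominant) auto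
  have bound: "J_num n rho \<mu> v k t \<le> enat (nat (\<mu> (k - 1) + 1))" if k: "k \<in> {2..n+1}" for k t
    using dominant'[OF k] k by (intro J_num_le phi_steps_vanish x) auto
  obtain m where m: "snd ((phi_step n rho 1 ^^ m) (\<mu>, v)) = 0"
    using phi_1_steps_vanish[OF assms(1) x] by blast
  then have "0 < m" using nz by (cases m) auto
  then have bound_1: "J_num n rho \<mu> v 1 t \<le> enat m" for t using m by (intro J_num_le) auto
  have "\<exists>N::nat. \<forall>J\<in>J_set n rho \<mu> v. J \<le> enat N"
  proof (intro exI ballI)
    fix J assume "J \<in> J_set n rho \<mu> v"
    then obtain k t where J: "J = J_num n rho \<mu> v k t" and k: "1 \<le> k" "k \<le> n + 1"
      by (auto simp: J_set_def)
    show "J \<le> enat (m + (\<Sum>i=1..n. nat (\<mu> i + 1)))"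
    proof (cases "k = 1")
      case True
      have "J \<le> enat m" using bound_1 True by (simp add: J)
      also have "\<dots> \<le> enat (m + (\<Sum>i=1..n. nat (\<mu> i + 1)))" by simp
      finally show ?thesis .
    next
      case False
      have "J \<le> enat (nat (\<mu> (k - 1) + 1))" using bound[of k t] False k by (simp add: J)
      also have "nat (\<mu> (k - 1) + 1) \<le> (\<Sum>i=1..n. nat (\<mu> i + 1))"
        using False k by (intro member_le_sum) auto
      then have "enat (nat (\<mu> (k - 1) + 1)) \<le> enat (m + (\<Sum>i=1..n. nat (\<mu> i + 1)))" by simp
      finally show ?thesis .
    qed
  qed
  moreover have "J_num n rho \<mu> v k s \<le> J_num n rho \<mu> v k t"
    if k: "k \<in> {2..n+1}" and le: "\<forall>l\<in>{1..k-1}. t l \<le> s l" for k s t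
    unfolding J_num_def[of n rho \<mu> v k t]
  proof (rule Inf_greatest, clarify)
    fix j :: nat assume j: "0 < j" "snd ((phi_step n rho k ^^ j) (phi_iter n rho \<mu> v t (k - 1))) = 0"
    obtain \<mu>' v' where y: "phi_iter n rho \<mu> v t (k - 1) = (\<mu>', v')" by fastforce
    have "hw_pair (\<mu>', v')" using hw_pair_iter[OF x, of "k - 1" t] k y by auto
    then have "(phi_step n rho k ^^ j) (phi_iter n rho \<mu>' v' (\<lambda>l. s l - t l) (k - 1))
      = (case (phi_step n rho k ^^ j) (\<mu>', v') of (\<mu>'', v'') \<Rightarrow> phi_iter n rho \<mu>'' v'' (\<lambda>l. s l - t l) (k - 1))"
      using k by (intro phi_steps_iter) auto
    moreover have "phi_iter n rho \<mu> v s (k - 1) = phi_iter n rho \<mu>' v' (\<lambda>l. s l - t l) (k - 1)"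
      using phi_iter_split[OF x, of "k - 1" t s] k le y by auto
    ultimately have "snd ((phi_step n rho k ^^ j) (phi_iter n rho \<mu> v s (k - 1))) = 0"
      using j(2) y k by (auto simp: phi_iter_zero split: prod.split)
    then show "J_num n rho \<mu> v k s \<le> enat j" using j(1) by (intro J_num_le)
  qed
  moreover have "\<exists>J::nat. J_num n rho \<mu> v k t = enat J \<and> int J \<le> \<mu> (k-1) + 1" if k: "k \<in> {2..n+1}" for k t
  proof -
    obtain J where J: "J_num n rho \<mu> v k t = enat J" using bound[OF k, of t] enat_ile by blast
    then have "J \<le> nat (\<mu> (k - 1) + 1)" using bound[OF k, of t] by simp
    then show ?thesis using J dominant'[OF k] by auto
  qed
  ultimately show ?thesis by (simp add: J_num_positive)
qed

end
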